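(* Let $m,n,r,d$ be integers with $m,n\ge2$, $d\ge1$, $0<r<\min\{m,n\}$, let $0\le a\le rd$, and set $\alpha=\lfloor a/(n-r)\rfloor$, $s=a\bmod(n-r)$, $\beta=\lfloor(rd-a)/(m-r)\rfloor$, $t=(rd-a)\bmod(m-r)$. Let $\mathcal{O}_a$ be the set of all $P\in\mathbb{C}[\lambda]^{m\times n}_d$ of normal rank $r$ whose $r$ invariant polynomials are all equal to $1$, whose partial multiplicity sequence at $\infty$ (with respect to $d$) consists only of zeros, whose left nullspace $\mathcal{N}_\ell(P)$ has minimal indices $\beta+1$ ($t$ times) and $\beta$ ($m-r-t$ times), and whose right nullspace $\mathcal{N}_r(P)$ has minimal indices $\alpha+1$ ($s$ times) and $\alpha$ ($n-r-s$ times). Then $\mathcal{O}_a$ equals the set of all products $L(\lambda)R(\lambda)$ with $L\in\mathbb{C}[\lambda]^{m\times r}$, $R\in\mathbb{C}[\lambda]^{r\times n}$ such that: the columns of $L$ form a minimal basis and the rows of $R$ form a minimal basis; $\mathcal{N}_\ell(L)$ has minimal indices $\beta+1$ ($t$ times) and $\beta$ ($m-r-t$ times); $\mathcal{N}_r(R)$ has minimal indices $\alpha+1$ ($s$ times) and $\alpha$ ($n-r-s$ times); and $\deg(L_{*i})+\deg(R_{i*})=d$ for $i=1,\dots,r$.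
   Context: $\mathbb{C}[\lambda]^{m\times n}_d$: complex $m\times n$ polynomial matrices of degree at most $d$; degree = maximum degree of entries, $\deg0=-\infty$; $L_{*i}$ is the $i$th column, $R_{i*}$ the $i$th row. Normal rank: rank over $\mathbb{C}(\lambda)$. A minimal basis of a subspace of $\mathbb{C}(\lambda)^k$ is a polynomial basis with minimal sum of degrees; the minimal indices of the subspace are the degrees of the vectors of any minimal basis. $\mathcal{N}_\ell(X)=\{y:yX=0\}$, $\mathcal{N}_r(X)=\{x:Xx=0\}$ over $\mathbb{C}(\lambda)$. Invariant polynomials are the nonzero diagonal entries $e_1|\cdots|e_r$ of the Smith form. The partial multiplicity sequence at $\alpha_0\in\mathbb{C}$ is the list of exponents of $(\lambda-\alpha_0)$ in $e_1,\dots,e_r$; the partial multiplicity sequence at $\infty$ with respect to $d$ is that of $\lambda^dP(1/\lambda)$ at $0$. *)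

theory Defs
  imports "Jordan_Normal_Form.Matrix" "Jordan_Normal_Form.Determinant"
    "Jordan_Normal_Form.DL_Rank" "Jordan_Normal_Form.VS_Connect"
    "HOL-Computational_Algebra.Polynomial" "HOL-Computational_Algebra.Fraction_Field"
    "HOL-Library.Multiset"
begin

type_synonym cpoly = "complex poly"
type_synonym rfun = "complex poly fract"

definition fr :: "cpoly \<Rightarrow> rfun" where "fr p = Fract p 1"

definition fvec :: "cpoly vec \<Rightarrow> rfun vec" where "fvec v = map_vec fr v"
definition fmat :: "cpoly mat \<Rightarrow> rfun mat" where "fmat A = map_mat fr A"

definition poly_mats :: "nat \<Rightarrow> nat \<Rightarrow> nat \<Rightarrow> cpoly mat set" where
  "poly_mats m n d = {P \<in> carrier_mat m n. \<forall>i<m. \<forall>j<n. degree (P $$ (i,j)) \<le> d}"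

definition normal_rank :: "cpoly mat \<Rightarrow> nat" where
  "normal_rank P = vec_space.rank (dim_row P) (fmat P :: rfun mat)"

text \<open>Degree of a polynomial vector: maximal degree of its entries
  (only used for nonzero vectors, so the convention deg 0 = -infinity is immaterial).\<close>
definition vdeg :: "cpoly vec \<Rightarrow> nat" where
  "vdeg v = Max (insert 0 {degree (v $ i) | i. i < dim_vec v})"

definition lincomb :: "nat \<Rightarrow> rfun list \<Rightarrow> rfun vec list \<Rightarrow> rfun vec" where
  "lincomb k cs vs = vec k (\<lambda>j. \<Sum>i<length vs. cs ! i * (vs ! i) $ j)"

definition fspan :: "nat \<Rightarrow> rfun vec list \<Rightarrow> rfun vec set" where
  "fspan k vs = {lincomb k cs vs | cs. length cs = length vs}"

definition findep :: "nat \<Rightarrow> rfun vec list \<Rightarrow> bool" where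
  "findep k vs \<longleftrightarrow> (\<forall>cs. length cs = length vs \<and> lincomb k cs vs = 0\<^sub>v k \<longrightarrow> (\<forall>c\<in>set cs. c = 0))"

definition poly_basis_of :: "nat \<Rightarrow> rfun vec set \<Rightarrow> cpoly vec list \<Rightarrow> bool" where
  "poly_basis_of k V vs \<longleftrightarrow> (\<forall>v\<in>set vs. v \<in> carrier_vec k)
     \<and> findep k (map fvec vs) \<and> fspan k (map fvec vs) = V"

definition minimal_basis_of :: "nat \<Rightarrow> rfun vec set \<Rightarrow> cpoly vec list \<Rightarrow> bool" where
  "minimal_basis_of k V vs \<longleftrightarrow> poly_basis_of k V vs \<and>
     (\<forall>ws. poly_basis_of k V ws \<longrightarrow> (\<Sum>v\<leftarrow>vs. vdeg v) \<le> (\<Sum>w\<leftarrow>ws. vdeg w))"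

definition is_minimal_basis :: "nat \<Rightarrow> cpoly vec list \<Rightarrow> bool" where
  "is_minimal_basis k vs \<longleftrightarrow> minimal_basis_of k (fspan k (map fvec vs)) vs"

text \<open>The subspace V has the multiset M of minimal indices (degrees of the vectors of a
  minimal basis; these do not depend on the chosen minimal basis).\<close>
definition has_minimal_indices :: "nat \<Rightarrow> rfun vec set \<Rightarrow> nat multiset \<Rightarrow> bool" where
  "has_minimal_indices k V M \<longleftrightarrow> (\<exists>vs. minimal_basis_of k V vs \<and> mset (map vdeg vs) = M)"

text \<open>Left and right nullspaces over C(lambda); row vectors y are represented as
  elements of C(lambda)^m.\<close>
definition left_null :: "cpoly mat \<Rightarrow> rfun vec set" where
  "left_null X = {y \<in> carrier_vec (dim_row X). transpose_mat (fmat X) *\<^sub>v y = 0\<^sub>v (dim_col X)}"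
definition right_null :: "cpoly mat \<Rightarrow> rfun vec set" where
  "right_null X = {x \<in> carrier_vec (dim_col X). fmat X *\<^sub>v x = 0\<^sub>v (dim_row X)}"

definition unimodular :: "nat \<Rightarrow> cpoly mat \<Rightarrow> bool" where
  "unimodular k U \<longleftrightarrow> U \<in> carrier_mat k k \<and> det U \<noteq> 0 \<and> degree (det U) = 0"

definition invariant_polys :: "cpoly mat \<Rightarrow> cpoly list \<Rightarrow> bool" where
  "invariant_polys P es \<longleftrightarrow> (\<exists>U V S.
     unimodular (dim_row P) U \<and> unimodular (dim_col P) V \<and> S = U * P * V \<and>
     (\<forall>i<dim_row P. \<forall>j<dim_col P. i \<noteq> j \<longrightarrow> S $$ (i,j) = 0) \<and>
     length es \<le> min (dim_row P) (dim_col P) \<and>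
     (\<forall>i<length es. S $$ (i,i) = es ! i \<and> es ! i \<noteq> 0 \<and> lead_coeff (es ! i) = 1) \<and>
     (\<forall>i. Suc i < length es \<longrightarrow> es ! i dvd es ! Suc i) \<and>
     (\<forall>i. length es \<le> i \<and> i < min (dim_row P) (dim_col P) \<longrightarrow> S $$ (i,i) = 0))"

definition partial_mult_seq :: "cpoly mat \<Rightarrow> complex \<Rightarrow> nat list \<Rightarrow> bool" where
  "partial_mult_seq P z pm \<longleftrightarrow> (\<exists>es. invariant_polys P es \<and> pm = map (order z) es)"

text \<open>Reversal lambda^d P(1/lambda) (entries of P have degree at most d).\<close>
definition rev_mat :: "nat \<Rightarrow> cpoly mat \<Rightarrow> cpoly mat" where
  "rev_mat d P = map_mat (\<lambda>p. monom 1 (d - degree p) * reflect_poly p) P"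

definition partial_mult_seq_infty :: "nat \<Rightarrow> cpoly mat \<Rightarrow> nat list \<Rightarrow> bool" where
  "partial_mult_seq_infty d P pm \<longleftrightarrow> partial_mult_seq (rev_mat d P) 0 pm"

end

theory Submission
  imports Defs "HOL-Computational_Algebra.Fundamental_Theorem_Algebra"
begin

text \<open>
  If \<open>P\<close> has trivial Smith form, then \<open>P = L\<^sub>0 * R\<^sub>0\<close> with polynomially one-sided invertible
  factors. Take for the rows of \<open>R\<close> a minimal basis of the row space of \<open>R\<^sub>0\<close>; then
  \<open>R\<^sub>0 = T * R\<close> with \<open>T\<close> unimodular and \<open>P = L * R\<close> with \<open>L = L\<^sub>0 * T\<close>. By the predictable
  degree property of \<open>R\<close>, column \<open>j\<close> of \<open>L\<close> has degree at most \<open>d\<close> minus that of row \<open>j\<close> of \<open>R\<close>, so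
  the reversal of \<open>P\<close> is the product of the correspondingly reversed factors. As \<open>P\<close> has no
  eigenvalue at infinity, this reversal still has rank \<open>r\<close> at \<open>0\<close>; hence so does the reversed \<open>L\<close>,
  which says both that the degrees add up to \<open>d\<close> and that \<open>L\<close> is column reduced, i.e. minimal.
  Conversely, a minimal basis has full rank at every point and is column reduced, so both \<open>L * R\<close>
  and its reversal are products of factors of full rank everywhere and have trivial Smith forms.
  The nullspaces of \<open>P\<close> are those of its factors, so the prescribed minimal indices are carried over.
\<close>

section \<open>Injective matrices and polynomial bases\<close>

text \<open>One notion of full column rank for several rings: over \<open>rfun\<close> it expresses
  independence of a polynomial basis, over \<open>complex\<close> it is applied to values at a point
  and to leading coefficients.\<close>

definition inj_mat :: "'a::semiring_0 mat \<Rightarrow> bool" where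
  "inj_mat A \<longleftrightarrow> (\<forall>c\<in>carrier_vec (dim_col A). A *\<^sub>v c = 0\<^sub>v (dim_row A) \<longrightarrow> c = 0\<^sub>v (dim_col A))"

lemma inj_matI:
  assumes "A \<in> carrier_mat n r"
    and "\<And>c. c \<in> carrier_vec r \<Longrightarrow> A *\<^sub>v c = 0\<^sub>v n \<Longrightarrow> c = 0\<^sub>v r"
  shows "inj_mat A"
  using assms unfolding inj_mat_def by auto

lemma inj_matD:
  assumes "A \<in> carrier_mat n r" "inj_mat A" "c \<in> carrier_vec r" "A *\<^sub>v c = 0\<^sub>v n"
  shows "c = 0\<^sub>v r"
  using assms unfolding inj_mat_def by auto

lemma inj_mat_left_inverse:
  fixes A :: "'a::semiring_1 mat"
  assumes A: "A \<in> carrier_mat n r" and B: "B \<in> carrier_mat r n" and BA: "B * A = 1\<^sub>m r"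
  shows "inj_mat A"
proof (rule inj_matI[OF A])
  fix c :: "'a vec" assume c: "c \<in> carrier_vec r" and 0: "A *\<^sub>v c = 0\<^sub>v n"
  have "c = (B * A) *\<^sub>v c" using BA c by simp
  also have "\<dots> = B *\<^sub>v (A *\<^sub>v c)" using A B c by simp
  also have "\<dots> = 0\<^sub>v r" unfolding 0 using B by (intro eq_vecI) auto
  finally show "c = 0\<^sub>v r" .
qed

lemma inj_mat_multD:
  fixes A :: "'a::comm_semiring_1 mat"
  assumes A: "A \<in> carrier_mat n k" and B: "B \<in> carrier_mat k r" and inj: "inj_mat (A * B)"
  shows "inj_mat B"
proof (rule inj_matI[OF B])
  fix c :: "'a vec" assume c: "c \<in> carrier_vec r" and 0: "B *\<^sub>v c = 0\<^sub>v k"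
  have "(A * B) *\<^sub>v c = A *\<^sub>v (B *\<^sub>v c)" using A B c by simp
  also have "\<dots> = 0\<^sub>v n" unfolding 0 using A by (intro eq_vecI) auto
  finally show "c = 0\<^sub>v r" by (rule inj_matD[OF mult_carrier_mat[OF A B] inj c])
qed

lemma inj_mat_mult:
  fixes A :: "'a::comm_semiring_1 mat"
  assumes A: "A \<in> carrier_mat n k" and B: "B \<in> carrier_mat k r"
    and "inj_mat A" "inj_mat B"
  shows "inj_mat (A * B)"
proof (rule inj_matI)
  show "A * B \<in> carrier_mat n r" using A B by simp
  fix c :: "'a vec" assume c: "c \<in> carrier_vec r" and 0: "A * B *\<^sub>v c = 0\<^sub>v n"
  have "A *\<^sub>v (B *\<^sub>v c) = 0\<^sub>v n" using A B c 0 by simp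
  then have "B *\<^sub>v c = 0\<^sub>v k" using inj_matD[OF A \<open>inj_mat A\<close>] B c by simp
  then show "c = 0\<^sub>v r" using inj_matD[OF B \<open>inj_mat B\<close> c] by simp
qed

text \<open>The rectangular identity. For \<open>r \<le> m\<close> it selects the first
  \<open>r\<close> columns of a square matrix, and it pads with zero rows when multiplied from the
  left.\<close>

definition emb :: "nat \<Rightarrow> nat \<Rightarrow> 'a::{zero,one} mat" where
  "emb m r = mat m r (\<lambda>(i,j). if i = j then 1 else 0)"

lemma emb_carrier [simp]: "emb m r \<in> carrier_mat m r"
  and dim_row_emb [simp]: "dim_row (emb m r) = m"
  and dim_col_emb [simp]: "dim_col (emb m r) = r"
  and index_emb [simp]: "i < m \<Longrightarrow> j < r \<Longrightarrow> emb m r $$ (i,j) = (if i = j then 1 else 0)"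
  and transpose_emb [simp]: "(emb m r)\<^sup>T = emb r m"
  by (auto simp: emb_def intro!: eq_matI)

lemma emb_mult_left:
  fixes A :: "'a::semiring_1 mat"
  assumes "A \<in> carrier_mat r n"
  shows "emb m r * A = mat m n (\<lambda>(i,j). if i < r then A $$ (i,j) else 0)"
  using assms by (intro eq_matI) (auto simp: scalar_prod_def if_distrib[of "\<lambda>x. x * _"] cong: if_cong)

lemma emb_mult_emb:
  assumes "r \<le> m"
  shows "emb r m * emb m r = (1\<^sub>m r :: 'a::semiring_1 mat)"
  using assms by (subst emb_mult_left[where n = r]) (auto intro!: eq_matI)

text \<open>A wide matrix, padded with zero rows to a square one, has determinant zero because the
  last unit vector lies in the kernel of the transpose. The kernel vector of the padded matrix is
  then also one of \<open>A\<close>.\<close>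

lemma inj_mat_dim_le:
  fixes A :: "'a::field mat"
  assumes A: "A \<in> carrier_mat r s" and inj: "inj_mat A"
  shows "s \<le> r"
proof (rule ccontr)
  assume "\<not> s \<le> r"
  then have rs: "r < s" by simp
  define B where "B = emb s r * A"
  have B: "B \<in> carrier_mat s s" unfolding B_def by (rule mult_carrier_mat[OF emb_carrier A])
  have B_eq: "B = mat s s (\<lambda>(i,j). if i < r then A $$ (i,j) else 0)"
    unfolding B_def using A by (rule emb_mult_left)
  define e :: "'a vec" where "e = unit_vec s (s - 1)"
  have "B\<^sup>T *\<^sub>v e = 0\<^sub>v s"
  proof (rule eq_vecI)
    fix i assume i: "i < dim_vec (0\<^sub>v s :: 'a vec)"
    have "(B\<^sup>T *\<^sub>v e) $ i = (\<Sum>k = 0..<s. B $$ (k,i) * e $ k)"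
      using B i by (auto simp: scalar_prod_def e_def)
    also have "\<dots> = 0"
      using i rs by (intro sum.neutral) (auto simp: B_eq e_def)
    finally show "(B\<^sup>T *\<^sub>v e) $ i = 0\<^sub>v s $ i" using i by simp
  qed (use B in auto)
  moreover have "e \<noteq> 0\<^sub>v s" using rs unfolding e_def by (metis diff_less gr_implies_not0 index_unit_vec(2) index_zero_vec(1) less_one neq0_conv zero_neq_one)
  moreover have "e \<in> carrier_vec s" unfolding e_def by simp
  ultimately have "\<exists>v. v \<in> carrier_vec s \<and> v \<noteq> 0\<^sub>v s \<and> B\<^sup>T *\<^sub>v v = 0\<^sub>v s" by blast
  then have "det (B\<^sup>T) = 0" using B det_0_iff_vec_prod_zero_field[of "B\<^sup>T" s] by simp
  then have "det B = 0" using det_transpose[OF B] by simp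
  then obtain v where v: "v \<in> carrier_vec s" "v \<noteq> 0\<^sub>v s" "B *\<^sub>v v = 0\<^sub>v s"
    using det_0_iff_vec_prod_zero_field[OF B] by auto
  have "emb r s * emb s r = (1\<^sub>m r :: 'a mat)" using rs by (simp add: emb_mult_emb)
  then have "A = (emb r s * emb s r) * A" using A by simp
  also have "\<dots> = emb r s * B" unfolding B_def using A by (simp add: assoc_mult_mat[of _ r s _ r _ s])
  finally have "A *\<^sub>v v = emb r s *\<^sub>v (B *\<^sub>v v)" using v(1) B by (simp add: assoc_mult_mat_vec[of _ r s _ s])
  also have "\<dots> = 0\<^sub>v r" unfolding v(3) by (intro eq_vecI) auto
  finally show False using inj_matD[OF A inj v(1)] v(2) by simp
qed

lemma right_inverse_dim_le:
  fixes A :: "'a::field mat"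
  assumes "A \<in> carrier_mat r s" "B \<in> carrier_mat s r" "A * B = 1\<^sub>m r"
  shows "r \<le> s"
  using inj_mat_dim_le[OF assms(2) inj_mat_left_inverse[OF assms(2,1,3)]] .

text \<open>The right inverse of \<open>C\<close> gives \<open>B * C\<close> and \<open>B\<close>
  the same column space, and the left inverse of \<open>B\<close> makes the columns of
  \<open>B\<close> independent.\<close>

lemma rank_full_factorization:
  fixes B :: "'a::field mat"
  assumes B: "B \<in> carrier_mat m k" and C: "C \<in> carrier_mat k n"
    and M: "M \<in> carrier_mat k m" and N: "N \<in> carrier_mat n k"
    and MB: "M * B = 1\<^sub>m k" and CN: "C * N = 1\<^sub>m k"
  shows "vec_space.rank m (B * C) = k"
proof -
  interpret vec_space "TYPE('a)" m .
  have BC: "B * C \<in> carrier_mat m n" using B C by simp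
  have "col_space (B * C) = col_space B"
  proof -
    have "(\<exists>y\<in>carrier_vec n. B * C *\<^sub>v y = z) \<longleftrightarrow> (\<exists>x\<in>carrier_vec k. B *\<^sub>v x = z)" for z
    proof
      assume "\<exists>y\<in>carrier_vec n. B * C *\<^sub>v y = z"
      then obtain y where y: "y \<in> carrier_vec n" "B * C *\<^sub>v y = z" by blast
      then have "B *\<^sub>v (C *\<^sub>v y) = z" using B C by simp
      then show "\<exists>x\<in>carrier_vec k. B *\<^sub>v x = z" using C y(1) by (intro bexI[of _ "C *\<^sub>v y"]) auto
    next
      assume "\<exists>x\<in>carrier_vec k. B *\<^sub>v x = z"
      then obtain x where x: "x \<in> carrier_vec k" "B *\<^sub>v x = z" by blast
      have "B * C *\<^sub>v (N *\<^sub>v x) = B *\<^sub>v (C *\<^sub>v (N *\<^sub>v x))"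
        using x B C N by (intro assoc_mult_mat_vec) auto
      also have "C *\<^sub>v (N *\<^sub>v x) = (C * N) *\<^sub>v x"
        using x C N by (intro assoc_mult_mat_vec[symmetric]) auto
      finally have "B * C *\<^sub>v (N *\<^sub>v x) = z" using CN x by simp
      then show "\<exists>y\<in>carrier_vec n. B * C *\<^sub>v y = z" using N x(1) by (intro bexI[of _ "N *\<^sub>v x"]) auto
    qed
    then show ?thesis
      using B C BC unfolding col_space_eq[OF B] col_space_eq[OF BC] by simp
  qed
  then have "rank (B * C) = rank B" unfolding rank_def col_space_def by simp
  also have "\<dots> = k"
  proof (rule lin_indpt_full_rank[OF B])
    \<comment> \<open>\<open>set (cols B)\<close> forgets repetitions, so distinctness is shown
      separately: applying \<open>M\<close> turns equal columns into equal unit vectors.\<close>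
    have "i = j" if "i < k" "j < k" "col B i = col B j" for i j
    proof -
      have "col (M * B) i = col (M * B) j" using that B M by (metis col_mult2)
      then have "unit_vec k i = (unit_vec k j :: 'a vec)" using MB that by simp
      then show ?thesis using that by simp
    qed
    then show dist: "distinct (cols B)" using B by (auto simp: distinct_conv_nth)
    show "lin_indpt (set (cols B))"
    proof
      assume "lin_dep (set (cols B))"
      then obtain v where "v \<in> carrier_vec k" "v \<noteq> 0\<^sub>v k" "B *\<^sub>v v = 0\<^sub>v m"
        using lin_depE[OF B _ dist] by blast
      then show False using inj_matD[OF B inj_mat_left_inverse[OF B M MB]] by blast
    qed
  qed
  finally show ?thesis .
qed

section \<open>Polynomial matrices over the field of fractions and at complex points\<close>

interpretation fr: inj_comm_ring_hom fr
  by unfold_locales (auto simp: fr_def Zero_fract_def One_fract_def eq_fract)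

definition evm :: "'a::comm_semiring_0 \<Rightarrow> 'a poly mat \<Rightarrow> 'a mat" where
  "evm z = map_mat (\<lambda>p. poly p z)"

interpretation ev: comm_ring_hom "\<lambda>p :: 'a::comm_ring_1 poly. poly p z" for z
  by unfold_locales auto

lemma fmat_carrier [simp]: "fmat A \<in> carrier_mat m n \<longleftrightarrow> A \<in> carrier_mat m n"
  and fmat_dim [simp]: "dim_row (fmat A) = dim_row A" "dim_col (fmat A) = dim_col A"
  and fmat_index [simp]: "i < dim_row A \<Longrightarrow> j < dim_col A \<Longrightarrow> fmat A $$ (i,j) = fr (A $$ (i,j))"
  and fmat_one [simp]: "fmat (1\<^sub>m n) = 1\<^sub>m n"
  and fmat_transpose: "fmat (A\<^sup>T) = (fmat A)\<^sup>T"
  unfolding fmat_def by (auto simp: fr.mat_hom_one)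

lemma fmat_mult: "A \<in> carrier_mat m k \<Longrightarrow> B \<in> carrier_mat k n \<Longrightarrow> fmat (A * B) = fmat A * fmat B"
  unfolding fmat_def by (rule fr.mat_hom_mult)

lemma evm_carrier [simp]: "evm z A \<in> carrier_mat m n \<longleftrightarrow> A \<in> carrier_mat m n"
  and evm_dim [simp]: "dim_row (evm z A) = dim_row A" "dim_col (evm z A) = dim_col A"
  and evm_index [simp]: "i < dim_row A \<Longrightarrow> j < dim_col A \<Longrightarrow> evm z A $$ (i,j) = poly (A $$ (i,j)) z"
  unfolding evm_def by auto

lemma evm_one [simp]: "evm (z :: 'a::comm_ring_1) (1\<^sub>m n) = 1\<^sub>m n"
  unfolding evm_def by (rule ev.mat_hom_one)

lemma evm_mult:
  "A \<in> carrier_mat m k \<Longrightarrow> B \<in> carrier_mat k n \<Longrightarrow>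
    evm (z :: 'a::comm_ring_1) (A * B) = evm z A * evm z B"
  unfolding evm_def by (rule ev.mat_hom_mult)

lemma det_evm: "det (evm (z :: 'a::comm_ring_1) A) = poly (det A) z"
  unfolding evm_def by (rule ev.hom_det)

lemma evm_mult_vec:
  "A \<in> carrier_mat m k \<Longrightarrow> v \<in> carrier_vec k \<Longrightarrow>
    evm (z :: 'a::comm_ring_1) A *\<^sub>v map_vec (\<lambda>p. poly p z) v = map_vec (\<lambda>p. poly p z) (A *\<^sub>v v)"
  unfolding evm_def by (rule ev.mult_mat_vec_hom[symmetric])

lemma fmat_mult_vec:
  "A \<in> carrier_mat m k \<Longrightarrow> v \<in> carrier_vec k \<Longrightarrow> fmat A *\<^sub>v fvec v = fvec (A *\<^sub>v v)"
  unfolding fmat_def fvec_def by (rule fr.mult_mat_vec_hom[symmetric])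

lemma inj_fmatD:
  assumes A: "A \<in> carrier_mat m n" and inj: "inj_mat (fmat A)"
    and v: "v \<in> carrier_vec n" and 0: "A *\<^sub>v v = 0\<^sub>v m"
  shows "v = 0\<^sub>v n"
proof -
  have "fmat A *\<^sub>v fvec v = 0\<^sub>v m"
    unfolding fmat_mult_vec[OF A v] 0 by (simp add: fvec_def fr.vec_hom_zero)
  then have "fvec v = 0\<^sub>v n"
    by (intro inj_matD[of "fmat A" m n, OF _ inj]) (use A v in \<open>auto simp: fvec_def\<close>)
  then show ?thesis unfolding fvec_def by simp
qed

section \<open>Polynomial bases as matrices\<close>

definition colrange :: "'a::semiring_0 mat \<Rightarrow> 'a vec set" where
  "colrange A = {A *\<^sub>v c | c. c \<in> carrier_vec (dim_col A)}"

lemma lincomb_cols: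
  assumes L: "L \<in> carrier_mat k r" and c: "c \<in> carrier_vec r"
  shows "lincomb k (list_of_vec c) (map fvec (cols L)) = fmat L *\<^sub>v c"
  using assms
  by (intro eq_vecI)
    (auto simp: lincomb_def fvec_def scalar_prod_def list_of_vec_index lessThan_atLeast0 mult.commute intro!: sum.cong)

lemma list_of_vec_surj: "length cs = r \<Longrightarrow> \<exists>c\<in>carrier_vec r. cs = list_of_vec c"
  by (metis carrier_dim_vec dim_vec_of_list list_vec)

lemma fspan_cols:
  assumes L: "L \<in> carrier_mat k r"
  shows "fspan k (map fvec (cols L)) = colrange (fmat L)"
proof -
  have "fspan k (map fvec (cols L)) = {lincomb k (list_of_vec c) (map fvec (cols L)) | c. c \<in> carrier_vec r}"
  proof -
    have "(\<exists>cs. x = lincomb k cs (map fvec (cols L)) \<and> length cs = r) \<longleftrightarrow>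
        (\<exists>c. x = lincomb k (list_of_vec c) (map fvec (cols L)) \<and> c \<in> carrier_vec r)" for x
      by (metis carrier_vecD length_list_of_vec list_of_vec_surj)
    then show ?thesis unfolding fspan_def using L by simp
  qed
  then show ?thesis using lincomb_cols[OF L] L unfolding colrange_def by fastforce
qed

lemma findep_cols:
  assumes L: "L \<in> carrier_mat k r"
  shows "findep k (map fvec (cols L)) \<longleftrightarrow> inj_mat (fmat L)"
proof -
  have z: "(\<forall>x\<in>set (list_of_vec c). x = 0) \<longleftrightarrow> c = 0\<^sub>v r" if "c \<in> carrier_vec r" for c :: "rfun vec"
    using that by (auto simp: set_list_of_vec vec_eq_iff vec_set_def)
  have "findep k (map fvec (cols L)) \<longleftrightarrow>
      (\<forall>c\<in>carrier_vec r. fmat L *\<^sub>v c = 0\<^sub>v k \<longrightarrow> (\<forall>x\<in>set (list_of_vec c). x = 0))"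
  proof
    assume l: "findep k (map fvec (cols L))"
    show "\<forall>c\<in>carrier_vec r. fmat L *\<^sub>v c = 0\<^sub>v k \<longrightarrow> (\<forall>x\<in>set (list_of_vec c). x = 0)"
    proof (intro ballI impI)
      fix c x assume c: "c \<in> carrier_vec r" "fmat L *\<^sub>v c = 0\<^sub>v k" "x \<in> set (list_of_vec c)"
      then have "lincomb k (list_of_vec c) (map fvec (cols L)) = 0\<^sub>v k" using lincomb_cols[OF L] by simp
      moreover have "length (list_of_vec c) = length (map fvec (cols L))" using c L by simp
      ultimately show "x = 0" using l c(3) unfolding findep_def by blast
    qed
  next
    assume r: "\<forall>c\<in>carrier_vec r. fmat L *\<^sub>v c = 0\<^sub>v k \<longrightarrow> (\<forall>x\<in>set (list_of_vec c). x = 0)"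
    show "findep k (map fvec (cols L))" unfolding findep_def
    proof (intro allI impI)
      fix cs assume cs: "length cs = length (map fvec (cols L)) \<and> lincomb k cs (map fvec (cols L)) = 0\<^sub>v k"
      then obtain c where "c \<in> carrier_vec r" "cs = list_of_vec c"
        using list_of_vec_surj[of cs r] L by auto
      then show "\<forall>c\<in>set cs. c = 0" using r cs lincomb_cols[OF L] by auto
    qed
  qed
  then show ?thesis using z L unfolding inj_mat_def by simp
qed

text \<open>Translates the list-based notion into matrix language; from here on a polynomial basis
  is a matrix that is injective over \<open>rfun\<close> and has the given column range.\<close>

lemma poly_basis_of_cols:
  assumes L: "L \<in> carrier_mat k r"
  shows "poly_basis_of k V (cols L) \<longleftrightarrow> inj_mat (fmat L) \<and> colrange (fmat L) = V"
  unfolding poly_basis_of_def fspan_cols[OF L] findep_cols[OF L] using L cols_dim[of L] by auto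

lemma poly_basis_ofE:
  assumes "poly_basis_of k V ws"
  obtains W where "W \<in> carrier_mat k (length ws)" "cols W = ws"
    "inj_mat (fmat W)" "colrange (fmat W) = V"
proof -
  have ws: "cols (mat_of_cols k ws) = ws"
    using assms unfolding poly_basis_of_def by (intro cols_mat_of_cols) auto
  have W: "mat_of_cols k ws \<in> carrier_mat k (length ws)" by simp
  show ?thesis
    by (rule that[OF W ws]) (use assms poly_basis_of_cols[OF W, of V] ws in auto)
qed

lemma sum_list_vdeg_cols:
  "L \<in> carrier_mat k r \<Longrightarrow> (\<Sum>v\<leftarrow>cols L. vdeg v) = (\<Sum>j<r. vdeg (col L j))"
  by (simp add: sum_list_sum_nth lessThan_atLeast0)

section \<open>Unimodular completion\<close>

text \<open>Unimodularity with the inverse carried along, so that products and transposes need no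
  determinants. The lemmas below connect it with \<open>unimodular\<close> in both
  directions.\<close>

definition unit_pair :: "nat \<Rightarrow> cpoly mat \<Rightarrow> cpoly mat \<Rightarrow> bool" where
  "unit_pair k U V \<longleftrightarrow> U \<in> carrier_mat k k \<and> V \<in> carrier_mat k k \<and> U * V = 1\<^sub>m k \<and> V * U = 1\<^sub>m k"

lemma unit_pairD:
  assumes "unit_pair k U V"
  shows "U \<in> carrier_mat k k" "V \<in> carrier_mat k k" "U * V = 1\<^sub>m k" "V * U = 1\<^sub>m k"
  using assms unfolding unit_pair_def by auto

lemma unit_pair_one: "unit_pair k (1\<^sub>m k) (1\<^sub>m k)"
  unfolding unit_pair_def by simp

lemma unit_pair_transpose: "unit_pair k U V \<Longrightarrow> unit_pair k (U\<^sup>T) (V\<^sup>T)"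
  unfolding unit_pair_def by (auto simp flip: transpose_mult)

lemma unit_pair_mult:
  assumes "unit_pair k U V" "unit_pair k U' V'"
  shows "unit_pair k (U * U') (V' * V)"
proof -
  have *: "(A * B) * (C * D) = 1\<^sub>m k"
    if "A \<in> carrier_mat k k" "B \<in> carrier_mat k k" "C \<in> carrier_mat k k" "D \<in> carrier_mat k k"
      "B * C = 1\<^sub>m k" "A * D = 1\<^sub>m k" for A B C D :: "cpoly mat"
  proof -
    have "(A * B) * (C * D) = A * ((B * C) * D)"
      using that(1-4) by (simp add: assoc_mult_mat[of _ k k _ k _ k])
    then show ?thesis using that by simp
  qed
  show ?thesis using assms * unfolding unit_pair_def by (simp add: mult_carrier_mat[of _ k k])
qed

lemma unit_pair_unimodular:
  assumes "unit_pair k U V"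
  shows "unimodular k U"
proof -
  have "det U * det V = 1"
    using assms det_mult[of U k V] unfolding unit_pair_def by simp
  then have "is_unit (det U)" and "det U \<noteq> 0" by (metis dvd_triv_left, auto)
  then show ?thesis using assms is_unit_iff_degree unfolding unimodular_def unit_pair_def by blast
qed

text \<open>The adjugate, divided by the determinant, is a polynomial inverse because the
  determinant is a nonzero constant.\<close>

lemma unimodular_unit_pair:
  assumes "unimodular k U"
  obtains V where "unit_pair k U V"
proof -
  have U: "U \<in> carrier_mat k k" and "det U \<noteq> 0" "degree (det U) = 0"
    using assms unfolding unimodular_def by auto
  then obtain c where c: "det U * c = 1" by (metis dvdE is_unit_iff_degree)
  define V where "V = c \<cdot>\<^sub>m adj_mat U"
  have V: "V \<in> carrier_mat k k" using adj_mat(1)[OF U] unfolding V_def by simp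
  have "U * V = c \<cdot>\<^sub>m (U * adj_mat U)" "V * U = c \<cdot>\<^sub>m (adj_mat U * U)"
    unfolding V_def using U adj_mat(1)[OF U]
    by (auto simp: mult_smult_distrib[of _ k k _ k] mult_smult_assoc_mat[of _ k k _ k])
  then have "U * V = 1\<^sub>m k" "V * U = 1\<^sub>m k"
    unfolding adj_mat(2,3)[OF U] using c by (auto intro!: eq_matI simp: mult.commute)
  then show ?thesis using that U V unfolding unit_pair_def by blast
qed

section \<open>Triangular form by unimodular row operations\<close>

definition left_equiv :: "nat \<Rightarrow> cpoly mat \<Rightarrow> cpoly mat \<Rightarrow> bool" where
  "left_equiv m A B \<longleftrightarrow> (\<exists>U V. unit_pair m U V \<and> B = U * A)"

lemma left_equiv_refl: "A \<in> carrier_mat m n \<Longrightarrow> left_equiv m A A"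
  unfolding left_equiv_def using unit_pair_one by (metis left_mult_one_mat)

lemma left_equiv_trans:
  assumes "A \<in> carrier_mat m n" "left_equiv m A B" "left_equiv m B C"
  shows "left_equiv m A C"
proof -
  obtain U V U' V' where u: "unit_pair m U V" "unit_pair m U' V'" and "B = U * A" "C = U' * B"
    using assms unfolding left_equiv_def by blast
  then have "C = (U' * U) * A"
    using assms(1) unit_pairD[OF u(1)] unit_pairD[OF u(2)] by (simp add: assoc_mult_mat[of _ m m _ m _ n])
  then show ?thesis using unit_pair_mult[OF u(2,1)] unfolding left_equiv_def by blast
qed

lemma left_equiv_addrow:
  assumes "A \<in> carrier_mat m n" "k < m" "l < m" "k \<noteq> l"
  shows "left_equiv m A (addrow a k l A)"
proof -
  have "unit_pair m (addrow_mat m a k l) (addrow_mat m (- a) k l)"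
    unfolding unit_pair_def using assms addrow_mat_inv[of k m l a] addrow_mat_inv[of k m l "- a"] by simp
  then show ?thesis using addrow_mat[of A m n l a k] assms unfolding left_equiv_def by blast
qed

lemma left_equiv_swaprows:
  assumes "A \<in> carrier_mat m n" "k < m" "l < m"
  shows "left_equiv m A (swaprows k l A)"
proof -
  have "unit_pair m (swaprows_mat m k l) (swaprows_mat m k l)"
    unfolding unit_pair_def using assms swaprows_mat_inv[of k m l] by simp
  then show ?thesis using swaprows_mat[of A m n k l] assms unfolding left_equiv_def by blast
qed

text \<open>The Euclidean algorithm on the entries of column \<open>k\<close> in the rows from \<open>k\<close> on; these
  rows vanish in the columns before \<open>k\<close>, and the row operations keep it so.\<close>

lemma clear_column:
  assumes "A \<in> carrier_mat m n" "k < m" "k < n"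
    and "\<And>i j. k \<le> i \<Longrightarrow> i < m \<Longrightarrow> j < k \<Longrightarrow> A $$ (i,j) = 0"
    and "\<And>i j. j < i \<Longrightarrow> i < m \<Longrightarrow> j < k \<Longrightarrow> A $$ (i,j) = 0"
  shows "\<exists>B \<in> carrier_mat m n. left_equiv m A B \<and>
    (\<forall>i j. j < i \<and> i < m \<and> j < Suc k \<longrightarrow> B $$ (i,j) = 0)"
  using assms
\<comment> \<open>The measure adds 1 to the degree of each nonzero entry, so replacing a nonzero
  constant by \<open>0\<close> also lowers it.\<close>
proof (induction "\<Sum>i = k..<m. if A $$ (i,k) = 0 then 0 else Suc (degree (A $$ (i,k)))"
    arbitrary: A rule: less_induct)
  case less
  note A = less.prems(1) and k = less.prems(2,3) and z = less.prems(4,5)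
  let ?f = "\<lambda>p::cpoly. if p = 0 then 0 else Suc (degree p)"
  show ?case
  proof (cases "\<exists>i l. k \<le> i \<and> i < m \<and> k \<le> l \<and> l < m \<and> i \<noteq> l \<and> A $$ (i,k) \<noteq> 0 \<and> A $$ (l,k) \<noteq> 0")
    case True
    then obtain i l where il: "k \<le> i" "i < m" "k \<le> l" "l < m" "i \<noteq> l"
      "A $$ (i,k) \<noteq> 0" "A $$ (l,k) \<noteq> 0" "degree (A $$ (i,k)) \<le> degree (A $$ (l,k))"
      by (metis linorder_le_cases)
    define q where "q = - (A $$ (l,k) div A $$ (i,k))"
    define B where "B = addrow q l i A"
    have B: "B \<in> carrier_mat m n" using A unfolding B_def by simp
    have eq: "left_equiv m A B" unfolding B_def using il A by (intro left_equiv_addrow) auto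
    have ent: "B $$ (i',j) = (if i' = l then q * A $$ (i,j) + A $$ (i',j) else A $$ (i',j))"
      if "i' < m" "j < n" for i' j using that A unfolding B_def by auto
    have "B $$ (l,k) = A $$ (l,k) mod A $$ (i,k)"
      using ent[of l k] il k unfolding q_def by (simp add: minus_div_mult_eq_mod[symmetric])
    then have lt: "?f (B $$ (l,k)) < ?f (A $$ (l,k))"
      using il degree_mod_less[of "A $$ (i,k)" "A $$ (l,k)"] by auto
    have "(\<Sum>i = k..<m. ?f (B $$ (i,k))) < (\<Sum>i = k..<m. ?f (A $$ (i,k)))"
    proof (rule sum_strict_mono_ex1)
      show "\<forall>i'\<in>{k..<m}. ?f (B $$ (i',k)) \<le> ?f (A $$ (i',k))"
      proof
        fix i' assume "i' \<in> {k..<m}"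
        then show "?f (B $$ (i',k)) \<le> ?f (A $$ (i',k))"
          using lt ent[of i' k] k by (cases "i' = l") auto
      qed
      show "\<exists>i'\<in>{k..<m}. ?f (B $$ (i',k)) < ?f (A $$ (i',k))"
        using lt il by (intro bexI[of _ l]) simp_all
    qed simp
    moreover have "B $$ (i',j) = 0" if "k \<le> i'" "i' < m" "j < k" for i' j
      using that ent[of i' j] z(1)[of i j] z(1)[of i' j] il k by auto
    moreover have "B $$ (i',j) = 0" if "j < i'" "i' < m" "j < k" for i' j
      using that ent[of i' j] z(1)[of i j] z(2)[of j i'] il k by auto
    ultimately obtain C where "C \<in> carrier_mat m n" "left_equiv m B C"
      "\<forall>i j. j < i \<and> i < m \<and> j < Suc k \<longrightarrow> C $$ (i,j) = 0"
      using less.hyps[of B] B k by blast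
    then show ?thesis using left_equiv_trans[OF A eq] by blast
  next
    case False
    \<comment> \<open>At most one entry of column \<open>k\<close> in the rows from \<open>k\<close>
      on is nonzero; \<open>l\<close> is its row, which is swapped onto the diagonal.\<close>
    obtain l where l: "k \<le> l" "l < m" "\<And>i. k \<le> i \<Longrightarrow> i < m \<Longrightarrow> i \<noteq> l \<Longrightarrow> A $$ (i,k) = 0"
      using False k by (metis order_refl)
    define B where "B = swaprows k l A"
    have B: "B \<in> carrier_mat m n" using A unfolding B_def by simp
    have eq: "left_equiv m A B" unfolding B_def using l k A by (intro left_equiv_swaprows) auto
    have "B $$ (i,j) = 0" if "j < i" "i < m" "j < Suc k" for i j
    proof -
      have "B $$ (i,j) = (if k = i then A $$ (l,j) else if l = i then A $$ (k,j) else A $$ (i,j))"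
        using that A k unfolding B_def by simp
      then show ?thesis
        using that l z(1)[of l j] z(1)[of k j] z(2)[of j i] k l(3)[of k] l(3)[of i] by (cases "j = k") auto
    qed
    then show ?thesis using B eq by blast
  qed
qed

text \<open>Columns are cleared from left to right; \<open>n \<le> m\<close> ensures that column
  \<open>k\<close> has a diagonal position in row \<open>k\<close>.\<close>

lemma left_equiv_upper_triangular:
  assumes A: "A \<in> carrier_mat m n" and nm: "n \<le> m"
  shows "\<exists>B \<in> carrier_mat m n. left_equiv m A B \<and> (\<forall>i j. j < i \<and> i < m \<and> j < n \<longrightarrow> B $$ (i,j) = 0)"
proof -
  have "\<exists>B \<in> carrier_mat m n. left_equiv m A B \<and> (\<forall>i j. j < i \<and> i < m \<and> j < k \<longrightarrow> B $$ (i,j) = 0)"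
    if "k \<le> n" for k
    using that
  proof (induction k)
    case 0
    then show ?case using left_equiv_refl[OF A] A by auto
  next
    case (Suc k)
    then obtain B where B: "B \<in> carrier_mat m n" "left_equiv m A B"
      "\<forall>i j. j < i \<and> i < m \<and> j < k \<longrightarrow> B $$ (i,j) = 0" by auto
    then obtain C where "C \<in> carrier_mat m n" "left_equiv m B C"
      "\<forall>i j. j < i \<and> i < m \<and> j < Suc k \<longrightarrow> C $$ (i,j) = 0"
      using clear_column[of B m n k] Suc.prems nm by auto
    then show ?case using left_equiv_trans[OF A B(2)] by blast
  qed
  then show ?thesis by blast
qed

lemma inj_evm_unit_pair:
  assumes "unit_pair m U V"
  shows "inj_mat (evm z U)"
proof (rule inj_mat_left_inverse)
  note u = unit_pairD[OF assms]
  show "evm z U \<in> carrier_mat m m" "evm z V \<in> carrier_mat m m" using u by auto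
  show "evm z V * evm z U = 1\<^sub>m m" using evm_mult[OF u(2,1)] u(4) by simp
qed

text \<open>Full column rank at every complex point allows completion to a unimodular matrix. After
  row operations \<open>L\<close> becomes an upper triangular \<open>B\<close>, which is extended by
  unit columns to a square \<open>H\<close>. A kernel vector of \<open>H\<close> at a point would
  yield one of \<open>B\<close>, so \<open>det H\<close> has no complex root and is constant by the
  fundamental theorem of algebra.\<close>

lemma unit_pair_complete:
  assumes L: "L \<in> carrier_mat m r" and rm: "r \<le> m" and inj: "\<And>z. inj_mat (evm z L)"
  obtains U V where "unit_pair m U V" "L = U * emb m r"
proof -
  obtain B where B: "B \<in> carrier_mat m r" and eq: "left_equiv m L B"
    and tri: "\<And>i j. j < i \<Longrightarrow> i < m \<Longrightarrow> j < r \<Longrightarrow> B $$ (i,j) = 0"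
    using left_equiv_upper_triangular[OF L rm] by blast
  obtain U V where u: "unit_pair m U V" and BU: "B = U * L" using eq unfolding left_equiv_def by blast
  have Uc: "U \<in> carrier_mat m m" "V \<in> carrier_mat m m" using unit_pairD[OF u] by auto
  have injB: "inj_mat (evm z B)" for z
    unfolding BU evm_mult[OF Uc(1) L]
    by (rule inj_mat_mult[OF _ _ inj_evm_unit_pair[OF u] inj]) (use Uc L in auto)
  define H where "H = mat m m (\<lambda>(i,j). if j < r then B $$ (i,j) else if i = j then 1 else 0)"
  have H: "H \<in> carrier_mat m m" unfolding H_def by simp
  have "H * emb m r = B"
    using B rm by (intro eq_matI) (auto simp: H_def scalar_prod_def emb_def if_distrib[of "\<lambda>x. _ * x"] cong: if_cong)
  have "unimodular m H"
  proof -
    have "poly (det H) z \<noteq> 0" for z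
    proof
      assume "poly (det H) z = 0"
      then have "det (evm z H) = 0" by (simp add: det_evm)
      then obtain v where v: "v \<in> carrier_vec m" "v \<noteq> 0\<^sub>v m" "evm z H *\<^sub>v v = 0\<^sub>v m"
        using det_0_iff_vec_prod_zero_field[of "evm z H" m] H by auto
      have ent: "(\<Sum>j = 0..<m. evm z H $$ (i,j) * v $ j) = 0" if "i < m" for i
      proof -
        have "(evm z H *\<^sub>v v) $ i = (\<Sum>j = 0..<m. evm z H $$ (i,j) * v $ j)"
          using that H v(1) by (auto simp: scalar_prod_def)
        then show ?thesis using v(3) that by simp
      qed
      \<comment> \<open>From row \<open>r\<close> on \<open>H\<close> has the rows of the identity,
        since \<open>B\<close> vanishes below the diagonal.\<close>
      have tail: "v $ i = 0" if "r \<le> i" "i < m" for i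
      proof -
        have "evm z H $$ (i,j) * v $ j = (if j = i then v $ i else 0)" if "j < m" for j
          using \<open>r \<le> i\<close> \<open>i < m\<close> that H tri[of j i] by (auto simp: H_def)
        then have "(\<Sum>j = 0..<m. evm z H $$ (i,j) * v $ j) = (\<Sum>j = 0..<m. if j = i then v $ i else 0)"
          by (intro sum.cong) auto
        then show ?thesis using ent[OF that(2)] that by simp
      qed
      define c where "c = vec r (\<lambda>i. v $ i)"
      have c: "c \<in> carrier_vec r" unfolding c_def by simp
      have "evm z B *\<^sub>v c = 0\<^sub>v m"
      proof (rule eq_vecI)
        fix i assume "i < dim_vec (0\<^sub>v m :: complex vec)"
        then have i: "i < m" by simp
        have "(evm z B *\<^sub>v c) $ i = (\<Sum>j = 0..<r. evm z B $$ (i,j) * v $ j)"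
          using i B by (auto simp: scalar_prod_def c_def)
        also have "\<dots> = (\<Sum>j = 0..<r. evm z H $$ (i,j) * v $ j)"
          using i B H rm by (intro sum.cong) (auto simp: H_def)
        also have "\<dots> = (\<Sum>j = 0..<m. evm z H $$ (i,j) * v $ j)"
          using tail rm by (intro sum.mono_neutral_left) auto
        finally show "(evm z B *\<^sub>v c) $ i = 0\<^sub>v m $ i" using ent i by simp
      qed (use B in auto)
      then have c0: "c = 0\<^sub>v r" using inj_matD[of "evm z B" m r, OF _ injB c] B by simp
      have "v $ i = 0" if "i < r" for i
        using arg_cong[OF c0, of "\<lambda>w. w $ i"] that unfolding c_def by simp
      then have "v = 0\<^sub>v m" using tail v(1) by (intro eq_vecI) (auto, metis linorder_not_less)
      then show False using v(2) by simp
    qed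
    then have "constant (poly (det H))" using fundamental_theorem_of_algebra[of "det H"] by blast
    then have "degree (det H) = 0" using constant_degree[of "det H"] by simp
    then show ?thesis using \<open>\<And>z. poly (det H) z \<noteq> 0\<close> H unfolding unimodular_def by force
  qed
  then obtain H' where h: "unit_pair m H H'" using unimodular_unit_pair by blast
  have u': "unit_pair m V U" using u unfolding unit_pair_def by simp
  have "L = (V * U) * L" using unit_pairD[OF u] L by simp
  also have "\<dots> = V * B" unfolding BU using Uc L by (simp add: assoc_mult_mat[of _ m m _ m _ r])
  also have "\<dots> = (V * H) * emb m r"
    unfolding \<open>H * emb m r = B\<close>[symmetric] using Uc H by (simp add: assoc_mult_mat[of _ m m _ m _ r])
  finally show ?thesis using that[OF unit_pair_mult[OF u' h]] by blast
qed

text \<open>A matrix form of Bezout: the first \<open>r\<close> rows of the inverse of a unimodular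
  completion are a left inverse.\<close>

lemma poly_left_inverse:
  fixes L :: "cpoly mat"
  assumes L: "L \<in> carrier_mat m r" and rm: "r \<le> m" and inj: "\<And>z. inj_mat (evm z L)"
  obtains M where "M \<in> carrier_mat r m" "M * L = 1\<^sub>m r"
proof -
  obtain U V where u: "unit_pair m U V" and LU: "L = U * emb m r"
    using unit_pair_complete[OF assms] by blast
  note uD = unit_pairD[OF u]
  have "(emb r m * V) * L = emb r m * ((V * U) * emb m r)"
    unfolding LU using uD(1,2)
    by (simp add: assoc_mult_mat[of _ r m _ m _ r] assoc_mult_mat[of _ m m _ m _ r])
  also have "\<dots> = 1\<^sub>m r" using uD(4) emb_mult_emb[OF rm] by simp
  finally show ?thesis using that[of "emb r m * V"] uD(2) by (simp add: mult_carrier_mat[OF emb_carrier])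
qed

section \<open>Minimal bases are reduced\<close>

lemma degree_le_vdeg: "i < dim_vec v \<Longrightarrow> degree (v $ i) \<le> vdeg v"
  unfolding vdeg_def by (intro Max_ge) auto

lemma vdeg_le: "(\<And>i. i < dim_vec v \<Longrightarrow> degree (v $ i) \<le> D) \<Longrightarrow> vdeg v \<le> D"
  unfolding vdeg_def by (intro Max.boundedI) auto

lemma degree_le_coldeg:
  assumes "L \<in> carrier_mat k r" "i < k" "j < r"
  shows "degree (L $$ (i,j)) \<le> vdeg (col L j)"
  using assms degree_le_vdeg[of i "col L j"] by simp

section \<open>Reversal of polynomials and of matrix columns\<close>

definition rev_poly :: "nat \<Rightarrow> 'a::comm_ring_1 poly \<Rightarrow> 'a poly" where
  "rev_poly d p = monom 1 (d - degree p) * reflect_poly p"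

lemma rev_poly_0 [simp]: "rev_poly d 0 = 0"
  unfolding rev_poly_def by simp

lemma coeff_rev_poly:
  "degree p \<le> d \<Longrightarrow> coeff (rev_poly d p) i = (if i \<le> d then coeff p (d - i) else 0)"
  unfolding rev_poly_def by (auto simp: coeff_monom_mult coeff_reflect_poly intro!: arg_cong[of _ _ "coeff p"] coeff_eq_0)

text \<open>Over a domain the degrees of nonzero factors add up, hence so do the exponents of the
  padding monomials; the degree bounds keep the subtractions exact.\<close>

lemma rev_poly_mult:
  fixes p q :: "'a::idom poly"
  assumes "degree p \<le> a" "degree q \<le> b"
  shows "rev_poly (a + b) (p * q) = rev_poly a p * rev_poly b q"
proof (cases "p = 0 \<or> q = 0")
  case False
  then have "a + b - degree (p * q) = (a - degree p) + (b - degree q)"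
    using assms by (simp add: degree_mult_eq)
  then have "monom (1::'a) (a + b - degree (p * q)) = monom 1 (a - degree p) * monom 1 (b - degree q)"
    by (simp add: mult_monom)
  then show ?thesis unfolding rev_poly_def by (simp add: reflect_poly_mult ac_simps)
qed auto

lemma rev_poly_sum:
  assumes "finite S" "\<And>i. i \<in> S \<Longrightarrow> degree (f i) \<le> d"
  shows "rev_poly d (\<Sum>i\<in>S. f i) = (\<Sum>i\<in>S. rev_poly d (f i))"
  using assms
  by (intro poly_eqI) (simp add: coeff_rev_poly degree_sum_le coeff_sum)

lemma poly_rev_poly_0: "degree p \<le> d \<Longrightarrow> poly (rev_poly d p) 0 = coeff p d"
  by (simp add: poly_0_coeff_0 coeff_rev_poly)

lemma poly_rev_poly:
  fixes z :: "'a::field"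
  assumes "z \<noteq> 0" "degree p \<le> d"
  shows "poly (rev_poly d p) z = z ^ d * poly p (inverse z)"
  using assms by (simp add: rev_poly_def poly_reflect_poly_nz poly_monom power_add[symmetric] flip: mult.assoc)

text \<open>The bounds need not be attained: the coefficients at the bounds are the values of the
  reversals at \<open>0\<close>, and these multiply.\<close>

lemma coeff_mult_top:
  fixes p q :: "'a::idom poly"
  assumes "degree p \<le> a" "degree q \<le> b"
  shows "coeff (p * q) (a + b) = coeff p a * coeff q b"
proof -
  have "degree (p * q) \<le> a + b" using degree_mult_le[of p q] assms by linarith
  then have "coeff (p * q) (a + b) = poly (rev_poly (a + b) (p * q)) 0" by (simp add: poly_rev_poly_0)
  then show ?thesis using assms by (simp add: rev_poly_mult poly_rev_poly_0)
qed

text \<open>Every column gets its own degree bound, so that a product can be reversed with bounds of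
  the two factors that add up to \<open>d\<close> for each inner index.\<close>

definition colrev :: "(nat \<Rightarrow> nat) \<Rightarrow> 'a::comm_ring_1 poly mat \<Rightarrow> 'a poly mat" where
  "colrev e L = mat (dim_row L) (dim_col L) (\<lambda>(i,j). rev_poly (e j) (L $$ (i,j)))"

lemma colrev_carrier [simp]: "colrev e L \<in> carrier_mat m r \<longleftrightarrow> L \<in> carrier_mat m r"
  and colrev_dim [simp]: "dim_row (colrev e L) = dim_row L" "dim_col (colrev e L) = dim_col L"
  and colrev_index [simp]: "i < dim_row L \<Longrightarrow> j < dim_col L \<Longrightarrow> colrev e L $$ (i,j) = rev_poly (e j) (L $$ (i,j))"
  unfolding colrev_def carrier_mat_def by auto

text \<open>The right factor is given as a transpose, so its rows too are treated as columns. The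
  summand with inner index \<open>k\<close> is reversed with respect to
  \<open>e k + f k = d\<close>.\<close>

lemma rev_mat_mult:
  assumes L: "L \<in> carrier_mat m r" and Q: "Q \<in> carrier_mat n r"
    and eL: "\<And>i j. i < m \<Longrightarrow> j < r \<Longrightarrow> degree (L $$ (i,j)) \<le> e j"
    and fQ: "\<And>i j. i < n \<Longrightarrow> j < r \<Longrightarrow> degree (Q $$ (i,j)) \<le> f j"
    and d: "\<And>j. j < r \<Longrightarrow> e j + f j = d"
  shows "rev_mat d (L * Q\<^sup>T) = colrev e L * (colrev f Q)\<^sup>T"
proof (rule eq_matI)
  fix i j assume "i < dim_row (colrev e L * (colrev f Q)\<^sup>T)" "j < dim_col (colrev e L * (colrev f Q)\<^sup>T)"
  then have ij: "i < m" "j < n" using L Q by auto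
  have "rev_mat d (L * Q\<^sup>T) $$ (i,j) = rev_poly d (\<Sum>k = 0..<r. L $$ (i,k) * Q $$ (j,k))"
    using ij L Q unfolding rev_mat_def rev_poly_def by (simp add: scalar_prod_def)
  also have "\<dots> = (\<Sum>k = 0..<r. rev_poly d (L $$ (i,k) * Q $$ (j,k)))"
  proof (rule rev_poly_sum)
    fix k assume "k \<in> {0..<r}"
    then show "degree (L $$ (i,k) * Q $$ (j,k)) \<le> d"
      using degree_mult_le[of "L $$ (i,k)" "Q $$ (j,k)"] eL[of i k] fQ[of j k] d[of k] ij by simp
  qed simp
  also have "\<dots> = (\<Sum>k = 0..<r. rev_poly (e k) (L $$ (i,k)) * rev_poly (f k) (Q $$ (j,k)))"
    using ij d by (intro sum.cong) (simp_all add: eL fQ flip: rev_poly_mult)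
  also have "\<dots> = (colrev e L * (colrev f Q)\<^sup>T) $$ (i,j)"
    using ij L Q by (simp add: scalar_prod_def)
  finally show "rev_mat d (L * Q\<^sup>T) $$ (i,j) = (colrev e L * (colrev f Q)\<^sup>T) $$ (i,j)" .
qed (use L Q in \<open>auto simp: rev_mat_def\<close>)

text \<open>At a point \<open>z\<close> other than \<open>0\<close> the reversal is the value of
  \<open>L\<close> at \<open>inverse z\<close> with columns scaled by nonzero powers of
  \<open>z\<close>; only the point \<open>0\<close> is a condition of its own.\<close>

lemma inj_evm_colrev:
  fixes L :: "'a::field poly mat"
  assumes L: "L \<in> carrier_mat m r"
    and e: "\<And>i j. i < m \<Longrightarrow> j < r \<Longrightarrow> degree (L $$ (i,j)) \<le> e j"
    and inj: "\<And>z. inj_mat (evm z L)" and inj0: "inj_mat (evm 0 (colrev e L))"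
  shows "inj_mat (evm z (colrev e L))"
proof (cases "z = 0")
  case False
  have "evm z (colrev e L) = evm (inverse z) L * mat_diag r (\<lambda>j. z ^ e j)"
    using L False e by (subst mat_diag_mult_right[of _ m]) (auto intro!: eq_matI simp: poly_rev_poly)
  moreover have "inj_mat (mat_diag r (\<lambda>j. z ^ e j))"
  proof (rule inj_mat_left_inverse[of _ r r])
    show "mat_diag r (\<lambda>j. inverse (z ^ e j)) * mat_diag r (\<lambda>j. z ^ e j) = 1\<^sub>m r"
      using False by simp
  qed simp_all
  ultimately show ?thesis
    using inj_mat_mult[of "evm (inverse z) L" m r "mat_diag r (\<lambda>j. z ^ e j)" r] inj L by simp
qed (use inj0 in simp)

text \<open>The matrix of highest column degree coefficients, obtained as the value of the reversal
  at \<open>0\<close>. Its injectivity says that \<open>L\<close> is column reduced.\<close>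

definition leadmat :: "cpoly mat \<Rightarrow> complex mat" where
  "leadmat L = evm 0 (colrev (\<lambda>j. vdeg (col L j)) L)"

lemma leadmat_carrier [simp]: "leadmat L \<in> carrier_mat k r \<longleftrightarrow> L \<in> carrier_mat k r"
  unfolding leadmat_def by simp

lemma leadmat_index:
  "L \<in> carrier_mat k r \<Longrightarrow> i < k \<Longrightarrow> j < r \<Longrightarrow> leadmat L $$ (i,j) = coeff (L $$ (i,j)) (vdeg (col L j))"
  unfolding leadmat_def using degree_le_coldeg[of L k r i j] by (simp add: poly_rev_poly_0)

section \<open>Lowering the degree of a basis by exchanging a vector\<close>

lemma is_minimal_basis_cols:
  assumes L: "L \<in> carrier_mat k r"
  shows "is_minimal_basis k (cols L) \<longleftrightarrow> inj_mat (fmat L) \<and>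
    (\<forall>ws. poly_basis_of k (colrange (fmat L)) ws \<longrightarrow> (\<Sum>j<r. vdeg (col L j)) \<le> (\<Sum>w\<leftarrow>ws. vdeg w))"
  unfolding is_minimal_basis_def minimal_basis_of_def fspan_cols[OF L] poly_basis_of_cols[OF L]
    sum_list_vdeg_cols[OF L] by simp

text \<open>Steinitz exchange: over \<open>rfun\<close> the vector \<open>w\<close> is a combination
  of the columns of \<open>L\<close> with a nonzero coefficient at \<open>i\<close>, so putting it
  in place of column \<open>i\<close> gives another polynomial basis of the same space. Minimality
  compares the two degree sums.\<close>

lemma minimal_basis_exchange:
  assumes L: "L \<in> carrier_mat k r" and mb: "is_minimal_basis k (cols L)"
    and g: "g \<in> carrier_vec r" and i: "i < r" "g $ i \<noteq> 0"
    and f: "f \<noteq> 0" and w: "w \<in> carrier_vec k" and fw: "f \<cdot>\<^sub>v w = L *\<^sub>v g"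
  shows "vdeg (col L i) \<le> vdeg w"
proof -
  define L' where "L' = mat k r (\<lambda>(a,j). if j = i then w $ a else L $$ (a,j))"
  have L': "L' \<in> carrier_mat k r" unfolding L'_def by simp
  define h where "h j = fr (g $ j) / fr f" for j
  have hi: "h i \<noteq> 0" using i f unfolding h_def by simp
  have frw: "fr (w $ a) = (\<Sum>j = 0..<r. fr (L $$ (a,j)) * h j)" if a: "a < k" for a
  proof -
    have "f * w $ a = (f \<cdot>\<^sub>v w) $ a" using a w by simp
    also have "\<dots> = (\<Sum>j = 0..<r. L $$ (a,j) * g $ j)"
      unfolding fw using a L g by (simp add: scalar_prod_def)
    finally have "fr f * fr (w $ a) = (\<Sum>j = 0..<r. fr (L $$ (a,j)) * fr (g $ j))"
      by (simp flip: fr.hom_mult fr.hom_sum)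
    then have "fr (w $ a) = (\<Sum>j = 0..<r. fr (L $$ (a,j)) * fr (g $ j)) / fr f"
      using f by (simp add: field_simps)
    then show ?thesis unfolding h_def by (simp add: sum_divide_distrib)
  qed
  \<comment> \<open>The change of coordinates: column \<open>i\<close> of \<open>L'\<close> is the
    combination of the columns of \<open>L\<close> with coefficients \<open>h\<close>.\<close>
  define \<phi> where "\<phi> c = vec r (\<lambda>j. (if j = i then 0 else c $ j) + c $ i * h j)" for c :: "rfun vec"
  have \<phi>: "\<phi> c \<in> carrier_vec r" for c unfolding \<phi>_def by simp
  have L'c: "fmat L' *\<^sub>v c = fmat L *\<^sub>v \<phi> c" if c: "c \<in> carrier_vec r" for c
  proof (rule eq_vecI)
    fix a assume "a < dim_vec (fmat L *\<^sub>v \<phi> c)"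
    then have a: "a < k" using L by simp
    have "(fmat L' *\<^sub>v c) $ a = (\<Sum>j = 0..<r. fr (L' $$ (a,j)) * c $ j)"
      using a L' c by (simp add: scalar_prod_def)
    also have "\<dots> = (\<Sum>j = 0..<r. fr (L $$ (a,j)) * (if j = i then 0 else c $ j) +
        (if j = i then fr (w $ a) * c $ i else 0))"
      using a by (intro sum.cong) (auto simp: L'_def)
    also have "\<dots> = (\<Sum>j = 0..<r. fr (L $$ (a,j)) * (if j = i then 0 else c $ j)) + fr (w $ a) * c $ i"
      using i by (simp add: sum.distrib)
    also have "\<dots> = (\<Sum>j = 0..<r. fr (L $$ (a,j)) * \<phi> c $ j)"
      unfolding frw[OF a] by (simp add: \<phi>_def sum.distrib algebra_simps sum_distrib_left)
    also have "\<dots> = (fmat L *\<^sub>v \<phi> c) $ a"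
      using a L \<phi>[of c] by (simp add: scalar_prod_def)
    finally show "(fmat L' *\<^sub>v c) $ a = (fmat L *\<^sub>v \<phi> c) $ a" .
  qed (use L L' in auto)
  have inj: "inj_mat (fmat L)" using mb unfolding is_minimal_basis_cols[OF L] by simp
  have inj': "inj_mat (fmat L')"
  proof (rule inj_matI[of _ k r])
    fix c assume c: "c \<in> carrier_vec r" and "fmat L' *\<^sub>v c = 0\<^sub>v k"
    then have "\<phi> c = 0\<^sub>v r" using L'c inj_matD[of "fmat L" k r, OF _ inj \<phi>] L by simp
    then have z: "(if j = i then 0 else c $ j) + c $ i * h j = 0" if "j < r" for j
    proof -
      have "\<phi> c $ j = 0" using that \<open>\<phi> c = 0\<^sub>v r\<close> by simp
      then show ?thesis using that by (simp add: \<phi>_def)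
    qed
    then have "c $ i = 0" using z[OF i(1)] hi by simp
    then have "c $ j = 0" if "j < r" for j using z[OF that] by (cases "j = i") auto
    then show "c = 0\<^sub>v r" using c by (intro eq_vecI) auto
  qed (use L' in simp)
  have "colrange (fmat L') = colrange (fmat L)"
  proof (intro equalityI subsetI)
    fix x assume "x \<in> colrange (fmat L')"
    then obtain c where "c \<in> carrier_vec r" "x = fmat L' *\<^sub>v c" using L' unfolding colrange_def by auto
    then have "x = fmat L *\<^sub>v \<phi> c" using L'c by simp
    then show "x \<in> colrange (fmat L)" using \<phi>[of c] L unfolding colrange_def by auto
  next
    fix x assume "x \<in> colrange (fmat L)"
    then obtain b where b: "b \<in> carrier_vec r" "x = fmat L *\<^sub>v b" using L unfolding colrange_def by auto
    \<comment> \<open>The preimage of \<open>b\<close> under \<open>\<phi>\<close>, which exists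
      because \<open>h i\<close> is nonzero.\<close>
    define c where "c = vec r (\<lambda>j. if j = i then b $ i / h i else b $ j - b $ i / h i * h j)"
    have "c \<in> carrier_vec r" unfolding c_def by simp
    moreover have "\<phi> c = b" unfolding \<phi>_def c_def using b(1) hi i by (intro eq_vecI) auto
    ultimately have "x = fmat L' *\<^sub>v c" using L'c[of c] b(2) by simp
    then show "x \<in> colrange (fmat L')"
      using \<open>c \<in> carrier_vec r\<close> L' unfolding colrange_def by auto
  qed
  then have "poly_basis_of k (colrange (fmat L)) (cols L')" using inj' poly_basis_of_cols[OF L'] by simp
  then have le: "(\<Sum>j<r. vdeg (col L j)) \<le> (\<Sum>j<r. vdeg (col L' j))"
    using mb sum_list_vdeg_cols[OF L'] unfolding is_minimal_basis_cols[OF L] by metis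
  have "(\<Sum>j\<in>{..<r} - {i}. vdeg (col L j)) = (\<Sum>j\<in>{..<r} - {i}. vdeg (col L' j))"
    using L by (intro sum.cong arg_cong[of _ _ vdeg] eq_vecI refl) (auto simp: L'_def)
  moreover have "col L' i = w" using w i by (intro eq_vecI) (auto simp: L'_def)
  ultimately show ?thesis using le i by (simp add: sum.remove[of "{..<r}" i])
qed

text \<open>As \<open>degree 0 = 0\<close>, a strict drop can be asked of nonzero entries only.
  Independence makes \<open>w\<close> nonzero, so the degree of column \<open>i\<close> is positive
  and \<open>vdeg w\<close> is truly smaller, against the exchange lemma.\<close>

lemma minimal_basis_no_drop:
  assumes L: "L \<in> carrier_mat k r" and mb: "is_minimal_basis k (cols L)"
    and g: "g \<in> carrier_vec r" and i: "i < r" "g $ i \<noteq> 0"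
    and f: "f \<noteq> 0" and w: "w \<in> carrier_vec k" and fw: "f \<cdot>\<^sub>v w = L *\<^sub>v g"
    and drop: "\<And>a. a < k \<Longrightarrow> w $ a \<noteq> 0 \<Longrightarrow> degree (w $ a) < vdeg (col L i)"
  shows False
proof -
  have inj: "inj_mat (fmat L)" using mb unfolding is_minimal_basis_cols[OF L] by simp
  have "w \<noteq> 0\<^sub>v k"
  proof
    assume "w = 0\<^sub>v k"
    then have "L *\<^sub>v g = 0\<^sub>v k" using fw[symmetric] by (intro eq_vecI) auto
    then have "g = 0\<^sub>v r" using inj_fmatD[OF L inj g] by simp
    then show False using i by simp
  qed
  then obtain b where "b < k" "w $ b \<noteq> 0" using w by (auto simp: vec_eq_iff)
  then have pos: "0 < vdeg (col L i)" using drop by force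
  have "vdeg w \<le> vdeg (col L i) - 1"
  proof (rule vdeg_le)
    fix a assume "a < dim_vec w"
    then show "degree (w $ a) \<le> vdeg (col L i) - 1" using drop[of a] w by (cases "w $ a = 0") auto
  qed
  then show False using minimal_basis_exchange[OF L mb g i f w fw] pos by simp
qed

lemma support_max:
  fixes c :: "'a::zero vec" and f :: "nat \<Rightarrow> nat"
  assumes "c \<in> carrier_vec r" "c \<noteq> 0\<^sub>v r"
  obtains i where "i < r" "c $ i \<noteq> 0" "\<And>j. j < r \<Longrightarrow> c $ j \<noteq> 0 \<Longrightarrow> f j \<le> f i"
proof -
  define S where "S = {i. i < r \<and> c $ i \<noteq> 0}"
  have "S \<noteq> {}" "finite S" using assms by (auto simp: vec_eq_iff S_def)
  then have "Max (f ` S) \<in> f ` S" by (intro Max_in) auto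
  then obtain i where "i \<in> S" "f i = Max (f ` S)" by fastforce
  then show ?thesis using that[of i] \<open>finite S\<close> by (auto simp: S_def)
qed

text \<open>A kernel vector at \<open>z\<close> gives a constant combination of columns that is
  divisible by the linear factor at \<open>z\<close>. The quotient \<open>w\<close> has lower degree
  than the largest column involved, and exchanging it for that column contradicts
  minimality.\<close>

lemma minimal_basis_inj_evm:
  assumes L: "L \<in> carrier_mat k r" and mb: "is_minimal_basis k (cols L)"
  shows "inj_mat (evm z L)"
proof (rule inj_matI[of _ k r])
  fix c :: "complex vec" assume c: "c \<in> carrier_vec r" and 0: "evm z L *\<^sub>v c = 0\<^sub>v k"
  show "c = 0\<^sub>v r"
  proof (rule ccontr)
    assume "c \<noteq> 0\<^sub>v r"
    then obtain i where i: "i < r" "c $ i \<noteq> 0"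
      and mx: "\<And>j. j < r \<Longrightarrow> c $ j \<noteq> 0 \<Longrightarrow> vdeg (col L j) \<le> vdeg (col L i)"
      using support_max[OF c, of "\<lambda>j. vdeg (col L j)"] by blast
    define g where "g = map_vec (\<lambda>x. [:x:]) c"
    have g: "g \<in> carrier_vec r" using c unfolding g_def by simp
    define p where "p = L *\<^sub>v g"
    have "map_vec (\<lambda>p. poly p z) g = c" unfolding g_def by (intro eq_vecI) auto
    then have "map_vec (\<lambda>p. poly p z) p = 0\<^sub>v k"
      unfolding p_def using evm_mult_vec[OF L g, of z] 0 by simp
    moreover have "dim_vec p = k" using L unfolding p_def by simp
    ultimately have root: "poly (p $ a) z = 0" if "a < k" for a
      using that by (metis index_map_vec(1) index_zero_vec(1))
    define w where "w = vec k (\<lambda>a. p $ a div [:- z, 1:])"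
    have pw: "p $ a = [:- z, 1:] * w $ a" if "a < k" for a
    proof -
      have "[:- z, 1:] dvd p $ a" using root[OF that] poly_eq_0_iff_dvd by blast
      then have "[:- z, 1:] * (p $ a div [:- z, 1:]) = p $ a" by (rule dvd_mult_div_cancel)
      then show ?thesis using that unfolding w_def by (metis index_vec)
    qed
    have deg: "degree (p $ a) \<le> vdeg (col L i)" if a: "a < k" for a
    proof -
      have "p $ a = (\<Sum>j = 0..<r. smult (c $ j) (L $$ (a,j)))"
        using a L c unfolding p_def g_def by (simp add: scalar_prod_def)
      also have "degree \<dots> \<le> vdeg (col L i)"
      proof (rule degree_sum_le)
        fix j assume "j \<in> {0..<r}"
        then show "degree (smult (c $ j) (L $$ (a,j))) \<le> vdeg (col L i)"
          using mx[of j] degree_le_coldeg[OF L a, of j] by (cases "c $ j = 0") auto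
      qed simp
      finally show ?thesis .
    qed
    show False
    proof (rule minimal_basis_no_drop[OF L mb g])
      show "[:- z, 1:] \<cdot>\<^sub>v w = L *\<^sub>v g"
        unfolding p_def[symmetric] using pw L by (intro eq_vecI) (auto simp: w_def p_def)
      fix a assume "a < k" "w $ a \<noteq> 0"
      then show "degree (w $ a) < vdeg (col L i)"
        using deg[of a] unfolding pw[OF \<open>a < k\<close>] by (subst (asm) degree_mult_eq) auto
    qed (use i c in \<open>auto simp: g_def w_def\<close>)
  qed
qed (use L in simp)

text \<open>A kernel vector of the leading coefficients, with columns shifted by monomials to a
  common degree, gives a combination whose top coefficients cancel. It could replace the largest
  column involved.\<close>

lemma minimal_basis_inj_leadmat:
  assumes L: "L \<in> carrier_mat k r" and mb: "is_minimal_basis k (cols L)"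
  shows "inj_mat (leadmat L)"
proof (rule inj_matI[of _ k r])
  fix c :: "complex vec" assume c: "c \<in> carrier_vec r" and 0: "leadmat L *\<^sub>v c = 0\<^sub>v k"
  let ?d = "\<lambda>j. vdeg (col L j)"
  show "c = 0\<^sub>v r"
  proof (rule ccontr)
    assume "c \<noteq> 0\<^sub>v r"
    then obtain i where i: "i < r" "c $ i \<noteq> 0" and mx: "\<And>j. j < r \<Longrightarrow> c $ j \<noteq> 0 \<Longrightarrow> ?d j \<le> ?d i"
      using support_max[OF c, of ?d] by blast
    \<comment> \<open>The subtraction is exact wherever \<open>c $ j\<close> is nonzero, by the
      choice of \<open>i\<close>; elsewhere the monomial is zero.\<close>
    define g where "g = vec r (\<lambda>j. monom (c $ j) (?d i - ?d j))"
    have g: "g \<in> carrier_vec r" unfolding g_def by simp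
    define w where "w = L *\<^sub>v g"
    have w: "w \<in> carrier_vec k" unfolding w_def by (rule mult_mat_vec_carrier[OF L g])
    have wa: "w $ a = (\<Sum>j = 0..<r. L $$ (a,j) * monom (c $ j) (?d i - ?d j))" if "a < k" for a
      using that L unfolding w_def g_def by (simp add: scalar_prod_def)
    have deg: "degree (L $$ (a,j) * monom (c $ j) (?d i - ?d j)) \<le> ?d i"
      and top: "coeff (L $$ (a,j) * monom (c $ j) (?d i - ?d j)) (?d i) = leadmat L $$ (a,j) * c $ j"
      if a: "a < k" and j: "j < r" for a j
    proof -
      have le: "degree (L $$ (a,j)) \<le> ?d j" using degree_le_coldeg[OF L a j] .
      have le': "degree (monom (c $ j) (?d i - ?d j)) \<le> ?d i - ?d j" by (rule degree_monom_le)
      have "degree (L $$ (a,j) * monom (c $ j) (?d i - ?d j)) \<le> ?d i \<and>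
        coeff (L $$ (a,j) * monom (c $ j) (?d i - ?d j)) (?d i) = leadmat L $$ (a,j) * c $ j"
      proof (cases "c $ j = 0")
        case False
        then have eq: "?d j + (?d i - ?d j) = ?d i" using mx[OF j] by simp
        have "degree (L $$ (a,j) * monom (c $ j) (?d i - ?d j)) \<le> ?d i"
          using degree_mult_le[of "L $$ (a,j)" "monom (c $ j) (?d i - ?d j)"] le le' eq by linarith
        then show ?thesis
          using coeff_mult_top[OF le le'] leadmat_index[OF L a j] unfolding eq by simp
      qed simp
      then show "degree (L $$ (a,j) * monom (c $ j) (?d i - ?d j)) \<le> ?d i"
        "coeff (L $$ (a,j) * monom (c $ j) (?d i - ?d j)) (?d i) = leadmat L $$ (a,j) * c $ j" by auto
    qed
    show False
    proof (rule minimal_basis_no_drop[OF L mb g])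
      show "1 \<cdot>\<^sub>v w = L *\<^sub>v g" unfolding w_def by simp
      fix a assume a: "a < k" and nz: "w $ a \<noteq> 0"
      have "degree (w $ a) \<le> ?d i" unfolding wa[OF a] using deg[OF a] by (intro degree_sum_le) auto
      moreover have "coeff (w $ a) (?d i) = (leadmat L *\<^sub>v c) $ a"
        unfolding wa[OF a] coeff_sum using top[OF a] a c L leadmat_carrier[of L k r]
        by (simp add: scalar_prod_def)
      then have "coeff (w $ a) (?d i) = 0" using 0 a by simp
      ultimately show "degree (w $ a) < ?d i" using nz by (metis le_neq_implies_less leading_coeff_0_iff)
    qed (use i w in \<open>auto simp: g_def\<close>)
  qed
qed (use L in simp)

section \<open>Reduced matrices are minimal bases\<close>

text \<open>In a column reduced matrix the top terms of a combination cannot cancel: if the largest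
  value \<open>M\<close> of column degree plus coefficient degree exceeded \<open>D\<close>, the
  terms of degree \<open>M\<close> would give a nonzero kernel vector of
  \<open>leadmat L\<close>.\<close>

lemma predictable_degree:
  assumes L: "L \<in> carrier_mat k r" and inj: "inj_mat (leadmat L)" and g: "g \<in> carrier_vec r"
    and D: "\<And>a. a < k \<Longrightarrow> degree ((L *\<^sub>v g) $ a) \<le> D"
    and j: "j < r" "g $ j \<noteq> 0"
  shows "vdeg (col L j) + degree (g $ j) \<le> D"
proof -
  let ?d = "\<lambda>j. vdeg (col L j)"
  have "g \<noteq> 0\<^sub>v r" using j by auto
  then obtain i where i: "i < r" "g $ i \<noteq> 0"
    and mx: "\<And>j. j < r \<Longrightarrow> g $ j \<noteq> 0 \<Longrightarrow> ?d j + degree (g $ j) \<le> ?d i + degree (g $ i)"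
    using support_max[OF g, of "\<lambda>j. ?d j + degree (g $ j)"] by blast
  define M where "M = ?d i + degree (g $ i)"
  have "M \<le> D"
  proof (rule ccontr)
    assume MD: "\<not> M \<le> D"
    \<comment> \<open>At \<open>j = i\<close> this is the leading coefficient of
      \<open>g $ i\<close>, so \<open>c\<close> is nonzero.\<close>
    define c where "c = vec r (\<lambda>j. if g $ j = 0 then 0 else coeff (g $ j) (M - ?d j))"
    have c: "c \<in> carrier_vec r" unfolding c_def by simp
    have "leadmat L *\<^sub>v c = 0\<^sub>v k"
    proof (rule eq_vecI)
      fix a assume "a < dim_vec (0\<^sub>v k :: complex vec)"
      then have a: "a < k" by simp
      have "(leadmat L *\<^sub>v c) $ a = (\<Sum>j = 0..<r. leadmat L $$ (a,j) * c $ j)"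
        using a c L leadmat_carrier[of L k r] by (simp add: scalar_prod_def)
      also have "\<dots> = (\<Sum>j = 0..<r. coeff (L $$ (a,j) * g $ j) M)"
      proof (rule sum.cong)
        fix j assume "j \<in> {0..<r}"
        then have j: "j < r" by simp
        show "leadmat L $$ (a,j) * c $ j = coeff (L $$ (a,j) * g $ j) M"
        proof (cases "g $ j = 0")
          case False
          then have "?d j + degree (g $ j) \<le> M" using mx[OF j] unfolding M_def by simp
          then show ?thesis
            using coeff_mult_top[OF degree_le_coldeg[OF L a j], of "g $ j" "M - ?d j"] False j
            by (simp add: c_def leadmat_index[OF L a j])
        qed (use j in \<open>simp add: c_def\<close>)
      qed simp
      also have "\<dots> = coeff ((L *\<^sub>v g) $ a) M"
        using a L g by (simp add: scalar_prod_def coeff_sum)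
      also have "\<dots> = 0" using D[OF a] MD by (intro coeff_eq_0) simp
      finally show "(leadmat L *\<^sub>v c) $ a = 0\<^sub>v k $ a" using a by simp
    qed (use L leadmat_carrier[of L k r] in auto)
    then have "c = 0\<^sub>v r" using inj_matD[of "leadmat L" k r, OF _ inj c] L by simp
    then have "c $ i = 0" using i by simp
    then show False using i unfolding c_def M_def by simp
  qed
  then show ?thesis using mx[OF j] unfolding M_def by simp
qed

lemma colrange_col: "A \<in> carrier_mat n r \<Longrightarrow> j < r \<Longrightarrow> col A j \<in> colrange (A :: 'a::semiring_1 mat)"
proof -
  assume A: "A \<in> carrier_mat n r" and j: "j < r"
  then have "col A j = A *\<^sub>v unit_vec r j" by (intro eq_vecI) auto
  then show ?thesis using A unfolding colrange_def by auto
qed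

text \<open>\<open>L * M\<close> acts as the identity on the column range of
  \<open>L\<close>.\<close>

lemma colrange_factor:
  fixes L :: "'a::comm_semiring_1 mat"
  assumes L: "L \<in> carrier_mat k r" and M: "M \<in> carrier_mat r k" and inv: "M * L = 1\<^sub>m r"
    and W: "W \<in> carrier_mat k s" and sub: "colrange W \<subseteq> colrange L"
  shows "W = L * (M * W)"
proof (rule mat_col_eqI)
  fix j assume "j < dim_col (L * (M * W))"
  then have j: "j < s" using W by simp
  then obtain x where x: "x \<in> carrier_vec r" "col W j = L *\<^sub>v x"
    using colrange_col[OF W] sub L unfolding colrange_def by blast
  have "col (L * (M * W)) j = L *\<^sub>v (M *\<^sub>v col W j)"
    using col_mult2[of L k r "M * W" s j] col_mult2[of M r k W s j] L M W j by simp
  also have "M *\<^sub>v col W j = (M * L) *\<^sub>v x" unfolding x(2) using L M x(1) by simp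
  finally show "col W j = col (L * (M * W)) j" using inv x by simp
qed (use L W in auto)

lemma colrange_dim_le:
  fixes A :: "'a::field mat"
  assumes A: "A \<in> carrier_mat k r" and B: "B \<in> carrier_mat k s"
    and inj: "inj_mat A" and sub: "colrange A \<subseteq> colrange B"
  shows "r \<le> s"
proof -
  have "\<forall>j<r. \<exists>x. x \<in> carrier_vec s \<and> col A j = B *\<^sub>v x"
    using colrange_col[OF A] sub B unfolding colrange_def by blast
  then obtain x where x: "\<And>j. j < r \<Longrightarrow> x j \<in> carrier_vec s" "\<And>j. j < r \<Longrightarrow> col A j = B *\<^sub>v x j"
    by metis
  define X where "X = mat s r (\<lambda>(i,j). x j $ i)"
  have X: "X \<in> carrier_mat s r" unfolding X_def by simp
  have "A = B * X"
  proof (rule mat_col_eqI)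
    fix j assume "j < dim_col (B * X)"
    then have j: "j < r" using X by simp
    have "col X j = x j" using x(1)[OF j] j unfolding X_def by (intro eq_vecI) auto
    then show "col A j = col (B * X) j" using x(2)[OF j] col_mult2[OF B X j] by simp
  qed (use A B X in auto)
  then show ?thesis using inj_mat_dim_le[OF X inj_mat_multD[OF B X]] inj by simp
qed

text \<open>An inclusion of spaces over \<open>rfun\<close> becomes a factorization over
  polynomials, since the cofactor \<open>M * W\<close> has polynomial entries.\<close>

lemma poly_factor:
  assumes L: "L \<in> carrier_mat k r" and M: "M \<in> carrier_mat r k" and inv: "M * L = 1\<^sub>m r"
    and W: "W \<in> carrier_mat k s" and sub: "colrange (fmat W) \<subseteq> colrange (fmat L)"
  shows "W = L * (M * W)"
proof -
  have "fmat M * fmat L = 1\<^sub>m r" using fmat_mult[OF M L] inv by simp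
  then have "fmat W = fmat L * (fmat M * fmat W)"
    using L M W by (intro colrange_factor[OF _ _ _ _ sub]) auto
  also have "\<dots> = fmat (L * (M * W))"
    using fmat_mult[OF M W] fmat_mult[OF L mult_carrier_mat[OF M W]] by simp
  finally show ?thesis unfolding fmat_def by (rule fr.mat_hom_inj)
qed

text \<open>Another polynomial basis is \<open>L * T\<close> for a polynomial matrix \<open>T\<close> with nonzero determinant;
  a nonzero term of its Leibniz expansion matches the degrees of the two bases.\<close>

lemma minimal_basisI:
  assumes L: "L \<in> carrier_mat k r" and lead: "inj_mat (leadmat L)"
    and M: "M \<in> carrier_mat r k" and inv: "M * L = 1\<^sub>m r"
  shows "is_minimal_basis k (cols L)"
  unfolding is_minimal_basis_cols[OF L]
proof (intro conjI allI impI)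
  have finv: "fmat M * fmat L = 1\<^sub>m r" using fmat_mult[OF M L] inv by simp
  then show inj: "inj_mat (fmat L)" using L M by (intro inj_mat_left_inverse[of _ k r "fmat M"]) auto
  fix ws assume "poly_basis_of k (colrange (fmat L)) ws"
  then obtain W where W: "W \<in> carrier_mat k (length ws)" "cols W = ws"
    and injW: "inj_mat (fmat W)" and rW: "colrange (fmat W) = colrange (fmat L)"
    by (rule poly_basis_ofE)
  have "r \<le> length ws" "length ws \<le> r"
    using colrange_dim_le[of "fmat L" k r "fmat W" "length ws"]
      colrange_dim_le[of "fmat W" k "length ws" "fmat L" r] L W inj injW rW by auto
  then have Wr: "W \<in> carrier_mat k r" using W by simp
  define T where "T = M * W"
  have T: "T \<in> carrier_mat r r" unfolding T_def using M Wr by simp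
  have WLT: "W = L * T" unfolding T_def using poly_factor[OF L M inv Wr] rW by simp
  have "inj_mat (fmat T)"
    using inj_mat_multD[of "fmat L" k r "fmat T" r] fmat_mult[OF L T] injW L T WLT by simp
  then have "det (fmat T) \<noteq> 0"
    using det_0_iff_vec_prod_zero_field[of "fmat T" r] inj_matD[of "fmat T" r r] T by auto
  then have "det T \<noteq> 0" unfolding fmat_def by simp
  then obtain p where p: "p permutes {0..<r}" and "(\<Prod>i = 0..<r. T $$ (i, p i)) \<noteq> 0"
    unfolding det_def'[OF T] by (metis (no_types, lifting) mem_Collect_eq mult_zero_right sum.neutral)
  then have nz: "T $$ (i, p i) \<noteq> 0" if "i < r" for i using that by auto
  have pr: "p i < r" if "i < r" for i using permutes_in_image[OF p, of i] that by simp
  have "vdeg (col L i) \<le> vdeg (col W (p i))" if i: "i < r" for i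
  proof -
    \<comment> \<open>Column \<open>p i\<close> of \<open>W\<close> involves column \<open>i\<close>
      of \<open>L\<close> with the nonzero coefficient \<open>T $$ (i, p i)\<close>.\<close>
    have LT: "L *\<^sub>v col T (p i) = col W (p i)"
      unfolding WLT using col_mult2[OF L T pr[OF i]] by simp
    have "vdeg (col L i) + degree (col T (p i) $ i) \<le> vdeg (col W (p i))"
    proof (rule predictable_degree[OF L lead])
      show "col T (p i) $ i \<noteq> 0" using nz[OF i] i pr[OF i] T by simp
      show "degree ((L *\<^sub>v col T (p i)) $ a) \<le> vdeg (col W (p i))" if "a < k" for a
        unfolding LT using that Wr by (intro degree_le_vdeg) simp
    qed (use i T pr[OF i] in auto)
    then show ?thesis by simp
  qed
  then have "(\<Sum>j<r. vdeg (col L j)) \<le> (\<Sum>j<r. vdeg (col W (p j)))" by (intro sum_mono) simp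
  also have "\<dots> = (\<Sum>j<r. vdeg (col W j))"
    using sum.permute[of p "{..<r}" "\<lambda>j. vdeg (col W j)"] p by (simp add: lessThan_atLeast0 comp_def)
  also have "\<dots> = (\<Sum>w\<leftarrow>ws. vdeg w)" using sum_list_vdeg_cols[OF Wr] W(2) by simp
  finally show "(\<Sum>j<r. vdeg (col L j)) \<le> (\<Sum>w\<leftarrow>ws. vdeg w)" .
qed

section \<open>Smith forms and nullspaces\<close>

text \<open>Both factors complete to unimodular matrices; multiplying by the inverses of these
  leaves a product of two rectangular identities, which is the Smith form.\<close>

lemma invariant_polys_ones:
  assumes L: "L \<in> carrier_mat m r" and Q: "Q \<in> carrier_mat n r" and r: "r \<le> m" "r \<le> n"
    and injL: "\<And>z. inj_mat (evm z L)" and injQ: "\<And>z. inj_mat (evm z Q)"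
  shows "invariant_polys (L * Q\<^sup>T) (replicate r 1)"
proof -
  obtain U U' where u: "unit_pair m U U'" and LU: "L = U * emb m r"
    using unit_pair_complete[OF L r(1) injL] by blast
  obtain V V' where v: "unit_pair n V V'" and QV: "Q = V * emb n r"
    using unit_pair_complete[OF Q r(2) injQ] by blast
  note uD = unit_pairD[OF u] and vD = unit_pairD[OF unit_pair_transpose[OF v]]
  have u': "unimodular m U'"
    by (rule unit_pair_unimodular[of m U' U]) (use uD in \<open>simp add: unit_pair_def\<close>)
  have v': "unimodular n (V'\<^sup>T)"
    by (rule unit_pair_unimodular[of n _ "V\<^sup>T"]) (use vD in \<open>simp add: unit_pair_def\<close>)
  let ?S = "emb m r * emb r n :: cpoly mat"
  have QT: "Q\<^sup>T = emb r n * V\<^sup>T" unfolding QV using unit_pairD(1)[OF v] by (simp add: transpose_mult[of _ n n _ r])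
  have S: "?S \<in> carrier_mat m n" by (rule mult_carrier_mat[OF emb_carrier emb_carrier])
  have L': "U' * L = emb m r"
    unfolding LU using uD by (simp flip: assoc_mult_mat[of _ m m _ m _ r])
  have Q': "Q\<^sup>T * V'\<^sup>T = emb r n"
    unfolding QT using vD by (simp add: assoc_mult_mat[of _ r n _ n _ n])
  have "U' * (L * Q\<^sup>T) * V'\<^sup>T = (U' * L) * (Q\<^sup>T * V'\<^sup>T)"
    using uD(2) vD(2) L Q
    by (simp add: assoc_mult_mat[of _ m m _ r _ n] assoc_mult_mat[of _ m r _ n _ n] assoc_mult_mat[of _ m m _ n _ n]
        mult_carrier_mat[of _ r n] mult_carrier_mat[of _ m r])
  then have eq: "?S = U' * (L * Q\<^sup>T) * V'\<^sup>T" unfolding L' Q' by simp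
  have ent: "?S $$ (i,j) = (if i = j \<and> i < r then 1 else 0)" if "i < m" "j < n" for i j
    using that by (subst emb_mult_left[of _ r n]) auto
  have "dim_row (L * Q\<^sup>T) = m" "dim_col (L * Q\<^sup>T) = n" using L Q by auto
  then show ?thesis unfolding invariant_polys_def
    using u' v' eq ent r by (intro exI[of _ U'] exI[of _ "V'\<^sup>T"] exI[of _ ?S]) auto
qed

text \<open>Discarding the zero block of the Smith form keeps \<open>k\<close> columns of one
  unimodular matrix and \<open>k\<close> rows of another, which still have one-sided polynomial
  inverses.\<close>

lemma invariant_polysE:
  assumes P: "P \<in> carrier_mat m n" and es: "invariant_polys P es"
  defines "k \<equiv> length es"
  obtains A M B N where "k \<le> m" "k \<le> n" "A \<in> carrier_mat m k" "M \<in> carrier_mat k m"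
    "B \<in> carrier_mat k n" "N \<in> carrier_mat n k" "M * A = 1\<^sub>m k" "B * N = 1\<^sub>m k"
    "P = A * mat_diag k (\<lambda>i. es ! i) * B"
proof -
  obtain U V S where U: "unimodular m U" and V: "unimodular n V" and S: "S = U * P * V"
    and off: "\<And>i j. i < m \<Longrightarrow> j < n \<Longrightarrow> i \<noteq> j \<Longrightarrow> S $$ (i,j) = 0"
    and k: "k \<le> m" "k \<le> n" and diag: "\<And>i. i < k \<Longrightarrow> S $$ (i,i) = es ! i"
    and tail: "\<And>i. k \<le> i \<Longrightarrow> i < m \<Longrightarrow> i < n \<Longrightarrow> S $$ (i,i) = 0"
    using es P unfolding invariant_polys_def k_def by auto
  obtain U' where u: "unit_pair m U U'" using unimodular_unit_pair[OF U] .
  obtain V' where v: "unit_pair n V V'" using unimodular_unit_pair[OF V] .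
  note uD = unit_pairD[OF u] and vD = unit_pairD[OF v]
  let ?D = "mat_diag k (\<lambda>i. es ! i)"
  have Sc: "S \<in> carrier_mat m n" unfolding S using uD vD P by (metis mult_carrier_mat)
  have SD: "S = emb m k * ?D * emb k n"
  proof (rule eq_matI)
    fix i j assume "i < dim_row (emb m k * ?D * emb k n)" "j < dim_col (emb m k * ?D * emb k n)"
    then have ij: "i < m" "j < n" by auto
    have D: "?D * emb k n = mat k n (\<lambda>(i,j). es ! i * emb k n $$ (i,j))"
      by (rule mat_diag_mult_left) simp
    have "emb m k * ?D * emb k n = emb m k * (?D * emb k n)"
      by (rule assoc_mult_mat[of _ m k _ k _ n]) auto
    also have "\<dots> $$ (i,j) = (if i < k then es ! i * emb k n $$ (i,j) else 0)"
      unfolding D using ij by (subst emb_mult_left[of _ k n]) auto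
    also have "\<dots> = S $$ (i,j)"
      using off[OF ij] diag[of i] tail[of i] ij by (cases "i = j") auto
    finally show "S $$ (i,j) = (emb m k * ?D * emb k n) $$ (i,j)" by simp
  qed (use Sc in auto)
  have "P = (U' * U) * P * (V * V')" using uD vD P by simp
  also have "\<dots> = U' * S * V'"
    unfolding S using uD(1,2) vD(1,2) P
    by (simp add: assoc_mult_mat[of _ m m _ m _ n] assoc_mult_mat[of _ m m _ n _ n]
        assoc_mult_mat[of _ m n _ n _ n] mult_carrier_mat[of _ m m] mult_carrier_mat[of _ m n] mult_carrier_mat[of _ n n])
  also have "\<dots> = (U' * emb m k) * ?D * (emb k n * V')"
    unfolding SD using uD(2) vD(2)
    by (simp add: assoc_mult_mat[of _ m m _ k _ k] assoc_mult_mat[of _ m m _ k _ n] assoc_mult_mat[of _ m k _ k _ n]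
        assoc_mult_mat[of _ k k _ n _ n] assoc_mult_mat[of _ m m _ n _ n] assoc_mult_mat[of _ m k _ n _ n]
        mult_carrier_mat[of _ m k] mult_carrier_mat[of _ k n] mult_carrier_mat[of _ k k])
  finally have PAB: "P = (U' * emb m k) * ?D * (emb k n * V')" .
  show ?thesis
  proof (rule that[OF k _ _ _ _ _ _ PAB])
    show "U' * emb m k \<in> carrier_mat m k" "emb k m * U \<in> carrier_mat k m"
      "emb k n * V' \<in> carrier_mat k n" "V * emb n k \<in> carrier_mat n k"
      by (rule mult_carrier_mat[OF uD(2) emb_carrier] mult_carrier_mat[OF emb_carrier uD(1)]
          mult_carrier_mat[OF emb_carrier vD(2)] mult_carrier_mat[OF vD(1) emb_carrier])+
    have "(emb k m * U) * (U' * emb m k) = emb k m * ((U * U') * emb m k)"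
      using uD(1,2) by (simp add: assoc_mult_mat[of _ k m _ m _ k] assoc_mult_mat[of _ m m _ m _ k] mult_carrier_mat[of _ m m])
    then show "(emb k m * U) * (U' * emb m k) = 1\<^sub>m k" using uD(3) emb_mult_emb[OF k(1)] by simp
    have "(emb k n * V') * (V * emb n k) = emb k n * ((V' * V) * emb n k)"
      using vD(1,2) by (simp add: assoc_mult_mat[of _ k n _ n _ k] assoc_mult_mat[of _ n n _ n _ k] mult_carrier_mat[of _ n n])
    then show "(emb k n * V') * (V * emb n k) = 1\<^sub>m k" using vD(4) emb_mult_emb[OF k(2)] by simp
  qed
qed

lemma normal_rank_factorization:
  assumes A: "A \<in> carrier_mat m k" and B: "B \<in> carrier_mat k n"
    and M: "M \<in> carrier_mat k m" and N: "N \<in> carrier_mat n k"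
    and MA: "M * A = 1\<^sub>m k" and BN: "B * N = 1\<^sub>m k"
  shows "normal_rank (A * B) = k"
proof -
  have "vec_space.rank m (fmat A * fmat B) = k"
    by (rule rank_full_factorization[of _ m k _ n "fmat M" "fmat N"])
      (use A B M N MA BN in \<open>simp_all flip: fmat_mult\<close>)
  then show ?thesis using A unfolding normal_rank_def fmat_mult[OF A B] by simp
qed

section \<open>Nullspaces of a product\<close>

lemma left_null_mult:
  assumes L: "L \<in> carrier_mat m r" and R: "R \<in> carrier_mat r n" and inj: "inj_mat (fmat (R\<^sup>T))"
  shows "left_null (L * R) = left_null L"
proof -
  have "(fmat (L * R))\<^sup>T *\<^sub>v y = 0\<^sub>v n \<longleftrightarrow> (fmat L)\<^sup>T *\<^sub>v y = 0\<^sub>v r" if y: "y \<in> carrier_vec m" for y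
  proof -
    have c: "(fmat L)\<^sup>T \<in> carrier_mat r m" "(fmat R)\<^sup>T \<in> carrier_mat n r" using L R by auto
    have "(fmat (L * R))\<^sup>T = (fmat R)\<^sup>T * (fmat L)\<^sup>T"
      unfolding fmat_mult[OF L R] using L R by (intro transpose_mult[of _ m r _ n]) auto
    then have eq: "(fmat (L * R))\<^sup>T *\<^sub>v y = (fmat R)\<^sup>T *\<^sub>v ((fmat L)\<^sup>T *\<^sub>v y)"
      using c y by simp
    show ?thesis
    proof
      assume "(fmat (L * R))\<^sup>T *\<^sub>v y = 0\<^sub>v n"
      then show "(fmat L)\<^sup>T *\<^sub>v y = 0\<^sub>v r"
        unfolding eq using inj_matD[OF c(2), of "(fmat L)\<^sup>T *\<^sub>v y"] inj c(1) y by (simp add: fmat_transpose)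
    next
      assume "(fmat L)\<^sup>T *\<^sub>v y = 0\<^sub>v r"
      then show "(fmat (L * R))\<^sup>T *\<^sub>v y = 0\<^sub>v n" unfolding eq using c(2) by (intro eq_vecI) auto
    qed
  qed
  then show ?thesis using L R unfolding left_null_def by auto
qed

lemma right_null_mult:
  assumes L: "L \<in> carrier_mat m r" and R: "R \<in> carrier_mat r n" and inj: "inj_mat (fmat L)"
  shows "right_null (L * R) = right_null R"
proof -
  have "fmat (L * R) *\<^sub>v x = 0\<^sub>v m \<longleftrightarrow> fmat R *\<^sub>v x = 0\<^sub>v r" if x: "x \<in> carrier_vec n" for x
  proof -
    have c: "fmat L \<in> carrier_mat m r" "fmat R \<in> carrier_mat r n" using L R by auto
    have eq: "fmat (L * R) *\<^sub>v x = fmat L *\<^sub>v (fmat R *\<^sub>v x)"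
      unfolding fmat_mult[OF L R] using c x by simp
    show ?thesis
    proof
      assume "fmat (L * R) *\<^sub>v x = 0\<^sub>v m"
      then show "fmat R *\<^sub>v x = 0\<^sub>v r"
        unfolding eq using inj_matD[OF c(1) inj mult_mat_vec_carrier[OF c(2) x]] by simp
    next
      assume "fmat R *\<^sub>v x = 0\<^sub>v r"
      then show "fmat (L * R) *\<^sub>v x = 0\<^sub>v m" unfolding eq using c(1) by (intro eq_vecI) auto
    qed
  qed
  then show ?thesis using L R unfolding right_null_def by auto
qed

section \<open>Minimal factorizations\<close>

text \<open>Between \<open>M\<close> and \<open>N\<close> the common product becomes the identity,
  so \<open>M * A\<close> has the right inverse \<open>B * N\<close>. This bounds \<open>k\<close>
  by \<open>r\<close>; if they agree, the matrices are square, the inverse is two-sided, and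
  \<open>A\<close> is injective.\<close>

lemma factorization_rank:
  fixes A :: "'a::field mat"
  assumes A: "A \<in> carrier_mat m r" and B: "B \<in> carrier_mat r n"
    and C: "C \<in> carrier_mat m k" and E: "E \<in> carrier_mat k n"
    and M: "M \<in> carrier_mat k m" and N: "N \<in> carrier_mat n k"
    and eq: "A * B = C * E" and MC: "M * C = 1\<^sub>m k" and EN: "E * N = 1\<^sub>m k"
  shows "k \<le> r" and "k = r \<Longrightarrow> inj_mat A"
proof -
  have X: "M * A \<in> carrier_mat k r" and Y: "B * N \<in> carrier_mat r k" using A B M N by auto
  have "(M * A) * (B * N) = M * (A * B) * N"
    using A B M N by (simp add: assoc_mult_mat[of _ k m _ r _ k] assoc_mult_mat[of _ m r _ n _ k]
        assoc_mult_mat[of _ k m _ n _ k] mult_carrier_mat[of _ m r] mult_carrier_mat[of _ r n])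
  also have "\<dots> = (M * C) * (E * N)"
    unfolding eq using C E M N by (simp add: assoc_mult_mat[of _ k m _ k _ k] assoc_mult_mat[of _ m k _ n _ k]
        assoc_mult_mat[of _ k m _ n _ k] mult_carrier_mat[of _ m k] mult_carrier_mat[of _ k n])
  finally have XY: "(M * A) * (B * N) = 1\<^sub>m k" using MC EN by simp
  then show "k \<le> r" using right_inverse_dim_le[OF X Y] by simp
  assume "k = r"
  then have "(B * N) * (M * A) = 1\<^sub>m r" using mat_mult_left_right_inverse[OF _ _ XY] X Y by simp
  then have "inj_mat (M * A)" using inj_mat_left_inverse[OF X Y] by simp
  then show "inj_mat A" by (rule inj_mat_multD[OF M A])
qed

text \<open>Degree sums are natural numbers, so a least one is attained; comparing dimensions shows
  that the basis attaining it has \<open>r\<close> vectors.\<close>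

lemma minimal_basis_exists:
  assumes Q: "Q \<in> carrier_mat n r" and inj: "inj_mat (fmat Q)"
  obtains Q' where "Q' \<in> carrier_mat n r" "is_minimal_basis n (cols Q')"
    "colrange (fmat Q') = colrange (fmat Q)"
proof -
  have "poly_basis_of n (colrange (fmat Q)) (cols Q)" using poly_basis_of_cols[OF Q] inj by simp
  then obtain ws where ws: "poly_basis_of n (colrange (fmat Q)) ws"
    and least: "\<And>vs. poly_basis_of n (colrange (fmat Q)) vs \<Longrightarrow> (\<Sum>w\<leftarrow>ws. vdeg w) \<le> (\<Sum>v\<leftarrow>vs. vdeg v)"
    using ex_has_least_nat[of "poly_basis_of n (colrange (fmat Q))" _ "\<lambda>vs. \<Sum>v\<leftarrow>vs. vdeg v"] by blast
  from ws obtain W where W: "W \<in> carrier_mat n (length ws)" "cols W = ws"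
    and injW: "inj_mat (fmat W)" and rW: "colrange (fmat W) = colrange (fmat Q)"
    by (rule poly_basis_ofE)
  have "r \<le> length ws" "length ws \<le> r"
    using colrange_dim_le[of "fmat Q" n r "fmat W" "length ws"]
      colrange_dim_le[of "fmat W" n "length ws" "fmat Q" r] Q W inj injW rW by auto
  then have Wr: "W \<in> carrier_mat n r" using W by simp
  have "is_minimal_basis n (cols W)"
    unfolding is_minimal_basis_cols[OF Wr] rW using injW least W(2) sum_list_vdeg_cols[OF Wr] by simp
  then show ?thesis using that Wr rW by blast
qed

text \<open>The inclusion from left to right. \<open>Q\<close> is the transpose of the right factor,
  so the results on columns serve both factors.\<close>

lemma minimal_factorization:
  assumes P: "P \<in> poly_mats m n d" and rank: "normal_rank P = r"
    and es: "invariant_polys P es" "\<forall>e\<in>set es. e = 1"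
    and es': "invariant_polys (rev_mat d P) es'" "\<forall>e\<in>set es'. order 0 e = 0"
  obtains L Q where "L \<in> carrier_mat m r" "Q \<in> carrier_mat n r" "P = L * Q\<^sup>T"
    "is_minimal_basis m (cols L)" "is_minimal_basis n (cols Q)"
    "\<And>j. j < r \<Longrightarrow> vdeg (col L j) + vdeg (col Q j) = d"
proof -
  have Pc: "P \<in> carrier_mat m n" and Pd: "\<And>i j. i < m \<Longrightarrow> j < n \<Longrightarrow> degree (P $$ (i,j)) \<le> d"
    using P unfolding poly_mats_def by auto
  obtain A M B N where k: "length es \<le> m" "length es \<le> n"
    and A: "A \<in> carrier_mat m (length es)" and M: "M \<in> carrier_mat (length es) m"
    and B: "B \<in> carrier_mat (length es) n" and N: "N \<in> carrier_mat n (length es)"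
    and MA: "M * A = 1\<^sub>m (length es)" and BN: "B * N = 1\<^sub>m (length es)"
    and "P = A * mat_diag (length es) (\<lambda>i. es ! i) * B"
    using invariant_polysE[OF Pc es(1)] by metis
  moreover have "mat_diag (length es) (\<lambda>i. es ! i) = 1\<^sub>m (length es)"
    using es(2) by (intro eq_matI) (auto simp: mat_diag_def)
  ultimately have PAB: "P = A * B" by simp
  have kr: "length es = r" using normal_rank_factorization[OF A B M N MA BN] rank PAB by simp
  note k = k[unfolded kr] and A = A[unfolded kr] and M = M[unfolded kr] and B = B[unfolded kr]
    and N = N[unfolded kr] and MA = MA[unfolded kr] and BN = BN[unfolded kr]
  have Bt: "B\<^sup>T \<in> carrier_mat n r" and Nt: "N\<^sup>T \<in> carrier_mat r n" using B N by auto
  have NB: "N\<^sup>T * B\<^sup>T = 1\<^sub>m r" using transpose_mult[OF B N] BN by simp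
  have "inj_mat (fmat (B\<^sup>T))"
    by (rule inj_mat_left_inverse[of _ n r "fmat (N\<^sup>T)"]) (use Bt Nt NB in \<open>simp_all flip: fmat_mult\<close>)
  then obtain Q where Q: "Q \<in> carrier_mat n r" and mbQ: "is_minimal_basis n (cols Q)"
    and rQ: "colrange (fmat Q) = colrange (fmat (B\<^sup>T))"
    using minimal_basis_exists[OF Bt] by blast
  have leadQ: "inj_mat (leadmat Q)" by (rule minimal_basis_inj_leadmat[OF Q mbQ])
  obtain N' where N': "N' \<in> carrier_mat r n" and NQ: "N' * Q = 1\<^sub>m r"
    using poly_left_inverse[OF Q k(2) minimal_basis_inj_evm[OF Q mbQ]] by blast
  \<comment> \<open>\<open>T\<close> and \<open>T'\<close> are the transitions between
    \<open>B\<^sup>T\<close> and \<open>Q\<close>, polynomial in both directions because both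
    matrices have polynomial left inverses.\<close>
  define T where "T = N' * B\<^sup>T"
  define T' where "T' = N\<^sup>T * Q"
  have T: "T \<in> carrier_mat r r" and T': "T' \<in> carrier_mat r r"
    unfolding T_def T'_def using N' Bt Nt Q by auto
  have BQT: "B\<^sup>T = Q * T" unfolding T_def using poly_factor[OF Q N' NQ Bt] rQ by simp
  have QBT: "Q = B\<^sup>T * T'" unfolding T'_def using poly_factor[OF Bt Nt NB Q] rQ by simp
  have "T * T' = N' * (B\<^sup>T * T')" unfolding T_def using N' Bt T' by (rule assoc_mult_mat)
  then have TT': "T * T' = 1\<^sub>m r" using QBT NQ by simp
  define L where "L = A * T\<^sup>T"
  have L: "L \<in> carrier_mat m r" unfolding L_def using A T by simp
  have "B = (B\<^sup>T)\<^sup>T" by simp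
  also have "\<dots> = T\<^sup>T * Q\<^sup>T" unfolding BQT by (rule transpose_mult[OF Q T])
  finally have "P = A * (T\<^sup>T * Q\<^sup>T)" using PAB by simp
  then have PLQ: "P = L * Q\<^sup>T" unfolding L_def using A T Q by (simp add: assoc_mult_mat[of _ m r _ r _ n])
  define M' where "M' = T'\<^sup>T * M"
  have M': "M' \<in> carrier_mat r m" unfolding M'_def using T' M by simp
  have "M' * L = T'\<^sup>T * ((M * A) * T\<^sup>T)"
    unfolding M'_def L_def using T T' M A
    by (simp add: assoc_mult_mat[of _ r r _ m _ r] assoc_mult_mat[of _ r m _ r _ r] mult_carrier_mat[of _ m r])
  also have "\<dots> = (T * T')\<^sup>T" unfolding MA using transpose_mult[OF T T'] T by simp
  finally have M'L: "M' * L = 1\<^sub>m r" unfolding TT' by simp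
  let ?f = "\<lambda>j. vdeg (col Q j)"
  \<comment> \<open>Row \<open>i\<close> of \<open>P\<close> combines the columns of
    \<open>Q\<close> with the entries of row \<open>i\<close> of \<open>L\<close>, so the degree
    bound on \<open>P\<close> passes to these entries.\<close>
  have pred: "?f j + degree (L $$ (i,j)) \<le> d" if ij: "i < m" "j < r" "L $$ (i,j) \<noteq> 0" for i j
  proof -
    have "?f j + degree (row L i $ j) \<le> d"
    proof (rule predictable_degree[OF Q leadQ])
      fix a assume a: "a < n"
      have "(Q *\<^sub>v row L i) $ a = P $$ (i,a)"
        unfolding PLQ using a ij L Q by (simp add: comm_scalar_prod[of _ r])
      then show "degree ((Q *\<^sub>v row L i) $ a) \<le> d" using Pd[OF ij(1) a] by simp
    qed (use ij L in auto)
    then show ?thesis using ij L by simp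
  qed
  \<comment> \<open>Otherwise column \<open>j\<close> of \<open>L\<close> would be zero, against the
    left inverse \<open>M'\<close>. This makes the subtraction in \<open>e\<close> exact.\<close>
  have fd: "?f j \<le> d" if j: "j < r" for j
  proof (rule ccontr)
    assume "\<not> ?f j \<le> d"
    then have "L $$ (i,j) = 0" if "i < m" for i using pred[OF that j] by linarith
    then have "(M' * L) $$ (j,j) = 0" using j L M' by (simp add: scalar_prod_def)
    then show False using M'L j by simp
  qed
  define e where "e j = d - ?f j" for j
  have eL: "degree (L $$ (i,j)) \<le> e j" if "i < m" "j < r" for i j
    using pred[OF that] fd[OF that(2)] unfolding e_def by (cases "L $$ (i,j) = 0") auto
  have fQ: "degree (Q $$ (i,j)) \<le> ?f j" if "i < n" "j < r" for i j
    using degree_le_coldeg[OF Q that] .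
  have rev: "rev_mat d P = colrev e L * (colrev ?f Q)\<^sup>T"
    unfolding PLQ by (rule rev_mat_mult[OF L Q eL fQ]) (use fd in \<open>auto simp: e_def\<close>)
  have Prc: "rev_mat d P \<in> carrier_mat m n" unfolding rev_mat_def using Pc by simp
  define k' where "k' = length es'"
  define D where "D = mat_diag k' (\<lambda>i. es' ! i)"
  obtain A1 M1 B1 N1 where A1: "A1 \<in> carrier_mat m k'" and M1: "M1 \<in> carrier_mat k' m"
    and B1: "B1 \<in> carrier_mat k' n" and N1: "N1 \<in> carrier_mat n k'"
    and MA1: "M1 * A1 = 1\<^sub>m k'" and BN1: "B1 * N1 = 1\<^sub>m k'" and P1: "rev_mat d P = A1 * D * B1"
    using invariant_polysE[OF Prc es'(1)] unfolding k'_def D_def by metis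
  have D: "D \<in> carrier_mat k' k'" unfolding D_def by simp
  have AD: "A1 * D \<in> carrier_mat m k'" using A1 D by simp
  have Lr: "colrev e L \<in> carrier_mat m r" and Qr: "(colrev ?f Q)\<^sup>T \<in> carrier_mat r n"
    using L Q by auto
  have evP: "evm z (colrev e L) * evm z ((colrev ?f Q)\<^sup>T) = evm z (A1 * D) * evm z B1" for z
    using rev P1 evm_mult[OF Lr Qr] evm_mult[OF AD B1] by simp
  \<comment> \<open>The number \<open>k'\<close> of invariant polynomials of the reversal is not
    known beforehand. At the point \<open>1\<close> reversal does not change values, and the product
    of \<open>L\<close> and \<open>Q\<^sup>T\<close> has rank \<open>r\<close> there.\<close>
  have rk: "r \<le> k'"
  proof (rule factorization_rank(1))
    have 1: "evm 1 (colrev e L) = evm 1 L" "evm 1 ((colrev ?f Q)\<^sup>T) = evm 1 (Q\<^sup>T)"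
      using L Q eL fQ by (auto intro!: eq_matI simp: poly_rev_poly)
    show "evm 1 (A1 * D) * evm 1 B1 = evm 1 L * evm 1 (Q\<^sup>T)" using evP[of 1] unfolding 1 by simp
    show "evm 1 M' * evm 1 L = 1\<^sub>m r" using evm_mult[OF M' L, of 1] M'L by simp
    have "Q\<^sup>T * N'\<^sup>T = 1\<^sub>m r" using transpose_mult[OF N' Q] NQ by simp
    then show "evm 1 (Q\<^sup>T) * evm 1 (N'\<^sup>T) = 1\<^sub>m r"
      using evm_mult[of "Q\<^sup>T" r n "N'\<^sup>T" r 1] Q N' by simp
  qed (use AD B1 L Q M' N' in auto)
  \<comment> \<open>Order \<open>0\<close> at the origin means no root there; hence the diagonal
    factor is invertible at \<open>0\<close>.\<close>
  have nz: "poly (es' ! i) 0 \<noteq> 0" if "i < k'" for i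
  proof -
    have "es' ! i \<noteq> 0" using es'(1) that unfolding invariant_polys_def k'_def by auto
    then show ?thesis using es'(2) that by (simp add: order_root k'_def)
  qed
  define D' where "D' = mat_diag k' (\<lambda>i. inverse (poly (es' ! i) 0))"
  have D0: "evm 0 D = mat_diag k' (\<lambda>i. poly (es' ! i) 0)"
    unfolding D_def by (intro eq_matI) (auto simp: mat_diag_def)
  then have DD: "D' * evm 0 D = 1\<^sub>m k'"
    unfolding D'_def D0 mat_diag_diag using nz by (auto intro!: eq_matI simp: mat_diag_def)
  have D': "D' \<in> carrier_mat k' k'" unfolding D'_def by simp
  have "(D' * evm 0 M1) * evm 0 (A1 * D) = D' * ((evm 0 M1 * evm 0 A1) * evm 0 D)"
    unfolding evm_mult[OF A1 D] using D' M1 A1 D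
    by (simp add: assoc_mult_mat[of _ k' k' _ m _ k'] assoc_mult_mat[of _ k' m _ k' _ k'] mult_carrier_mat[of _ m k'])
  also have "evm 0 M1 * evm 0 A1 = 1\<^sub>m k'" using evm_mult[OF M1 A1, of 0] MA1 by simp
  finally have inv0: "(D' * evm 0 M1) * evm 0 (A1 * D) = 1\<^sub>m k'" using DD D by simp
  have BN0: "evm 0 B1 * evm 0 N1 = 1\<^sub>m k'" using evm_mult[OF B1 N1, of 0] BN1 by simp
  have D'M: "D' * evm 0 M1 \<in> carrier_mat k' m" using D' M1 by simp
  have c0: "evm 0 (colrev e L) \<in> carrier_mat m r" "evm 0 ((colrev ?f Q)\<^sup>T) \<in> carrier_mat r n"
    "evm 0 (A1 * D) \<in> carrier_mat m k'" "evm 0 B1 \<in> carrier_mat k' n" "evm 0 N1 \<in> carrier_mat n k'"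
    using Lr Qr AD B1 N1 by simp_all
  note fac0 = factorization_rank[OF c0(1-4) D'M c0(5) evP inv0 BN0]
  \<comment> \<open>Comparing factorizations at \<open>0\<close> gives \<open>k' \<le> r\<close>;
    with \<open>rk\<close> the two agree, and the reversed \<open>L\<close> is injective at
    \<open>0\<close>.\<close>
  have inj0: "inj_mat (evm 0 (colrev e L))" using fac0 rk by simp
  have degL: "vdeg (col L j) = e j" if j: "j < r" for j
  proof (rule antisym)
    show "vdeg (col L j) \<le> e j" using eL j L by (intro vdeg_le) simp
    show "e j \<le> vdeg (col L j)"
    proof (rule ccontr)
      assume lt: "\<not> e j \<le> vdeg (col L j)"
      \<comment> \<open>A column of degree below \<open>e j\<close> would turn into a zero column of
        an injective matrix.\<close>
      have "col (evm 0 (colrev e L)) j = 0\<^sub>v m"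
      proof (rule eq_vecI)
        fix i assume "i < dim_vec (0\<^sub>v m :: complex vec)"
        then have i: "i < m" by simp
        have "coeff (L $$ (i,j)) (e j) = 0"
          using degree_le_coldeg[OF L i j] lt by (intro coeff_eq_0) simp
        then show "col (evm 0 (colrev e L)) j $ i = 0\<^sub>v m $ i"
          using i j L eL[OF i j] by (simp add: poly_rev_poly_0)
      qed (use L in simp)
      moreover have "evm 0 (colrev e L) *\<^sub>v unit_vec r j = col (evm 0 (colrev e L)) j"
        using L j by (intro eq_vecI) auto
      ultimately have "unit_vec r j = (0\<^sub>v r :: complex vec)"
        using inj_matD[OF c0(1) inj0, of "unit_vec r j"] by simp
      then have "(unit_vec r j :: complex vec) $ j = 0" using j by simp
      then show False using j by simp
    qed
  qed
  have "leadmat L = evm 0 (colrev e L)"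
    unfolding leadmat_def using L degL by (intro eq_matI) auto
  then have "is_minimal_basis m (cols L)" using minimal_basisI[OF L _ M' M'L] inj0 by simp
  moreover have "vdeg (col L j) + ?f j = d" if "j < r" for j
    using degL[OF that] fd[OF that] unfolding e_def by simp
  ultimately show ?thesis using that[OF L Q PLQ _ mbQ] by blast
qed

text \<open>The inclusion from right to left. Reversed with their exact column degrees, the factors
  take the value \<open>leadmat\<close> at \<open>0\<close>, so they have full rank at every point,
  as the factors themselves do.\<close>

lemma minimal_product:
  assumes L: "L \<in> carrier_mat m r" and Q: "Q \<in> carrier_mat n r" and r: "r \<le> m" "r \<le> n"
    and mbL: "is_minimal_basis m (cols L)" and mbQ: "is_minimal_basis n (cols Q)"
    and deg: "\<And>j. j < r \<Longrightarrow> vdeg (col L j) + vdeg (col Q j) = d"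
  shows "L * Q\<^sup>T \<in> poly_mats m n d" and "normal_rank (L * Q\<^sup>T) = r"
    and "invariant_polys (L * Q\<^sup>T) (replicate r 1)"
    and "invariant_polys (rev_mat d (L * Q\<^sup>T)) (replicate r 1)"
proof -
  let ?e = "\<lambda>j. vdeg (col L j)" and ?f = "\<lambda>j. vdeg (col Q j)"
  note eL = degree_le_coldeg[OF L] and fQ = degree_le_coldeg[OF Q]
  note injL = minimal_basis_inj_evm[OF L mbL] and injQ = minimal_basis_inj_evm[OF Q mbQ]
  have "degree ((L * Q\<^sup>T) $$ (i,j)) \<le> d" if ij: "i < m" "j < n" for i j
  proof -
    have "(L * Q\<^sup>T) $$ (i,j) = (\<Sum>k = 0..<r. L $$ (i,k) * Q $$ (j,k))"
      using ij L Q by (simp add: scalar_prod_def)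
    also have "degree \<dots> \<le> d"
    proof (rule degree_sum_le)
      fix k assume "k \<in> {0..<r}"
      then show "degree (L $$ (i,k) * Q $$ (j,k)) \<le> d"
        using degree_mult_le[of "L $$ (i,k)" "Q $$ (j,k)"] eL[of i k] fQ[of j k] deg[of k] ij by simp
    qed simp
    finally show ?thesis .
  qed
  then show "L * Q\<^sup>T \<in> poly_mats m n d" using L Q unfolding poly_mats_def by simp
  obtain M where M: "M \<in> carrier_mat r m" "M * L = 1\<^sub>m r"
    using poly_left_inverse[OF L r(1) injL] by blast
  obtain N where N: "N \<in> carrier_mat r n" "N * Q = 1\<^sub>m r"
    using poly_left_inverse[OF Q r(2) injQ] by blast
  have "Q\<^sup>T * N\<^sup>T = 1\<^sub>m r" using transpose_mult[OF N(1) Q] N(2) by simp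
  then show "normal_rank (L * Q\<^sup>T) = r"
    using normal_rank_factorization[of L m r "Q\<^sup>T" n M "N\<^sup>T"] L Q M N by simp
  show "invariant_polys (L * Q\<^sup>T) (replicate r 1)"
    by (rule invariant_polys_ones[OF L Q r injL injQ])
  have "inj_mat (evm z (colrev ?e L))" for z
    by (rule inj_evm_colrev[OF L eL injL]) (use minimal_basis_inj_leadmat[OF L mbL] in \<open>simp_all add: leadmat_def\<close>)
  moreover have "inj_mat (evm z (colrev ?f Q))" for z
    by (rule inj_evm_colrev[OF Q fQ injQ]) (use minimal_basis_inj_leadmat[OF Q mbQ] in \<open>simp_all add: leadmat_def\<close>)
  ultimately have "invariant_polys (colrev ?e L * (colrev ?f Q)\<^sup>T) (replicate r 1)"
    using L Q r by (intro invariant_polys_ones[of _ m r _ n]) auto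
  then show "invariant_polys (rev_mat d (L * Q\<^sup>T)) (replicate r 1)"
    using rev_mat_mult[OF L Q eL fQ deg] by simp
qed

lemma minimal_basis_inj_fmat:
  "L \<in> carrier_mat k r \<Longrightarrow> is_minimal_basis k (cols L) \<Longrightarrow> inj_mat (fmat L)"
  by (simp add: is_minimal_basis_cols)

theorem theorem4p16:
  fixes m n r d a :: nat
  assumes "m \<ge> 2" and "n \<ge> 2" and "d \<ge> 1" and "0 < r" and "r < min m n"
    and "a \<le> r * d"
  defines "\<alpha> \<equiv> a div (n - r)" and "s \<equiv> a mod (n - r)"
    and "\<beta> \<equiv> (r * d - a) div (m - r)" and "t \<equiv> (r * d - a) mod (m - r)"
  shows
  "{P \<in> poly_mats m n d. normal_rank P = r
      \<and> (\<exists>es. invariant_polys P es \<and> (\<forall>e\<in>set es. e = 1))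
      \<and> (\<exists>pm. partial_mult_seq_infty d P pm \<and> (\<forall>x\<in>set pm. x = 0))
      \<and> has_minimal_indices m (left_null P)
           (replicate_mset t (\<beta> + 1) + replicate_mset (m - r - t) \<beta>)
      \<and> has_minimal_indices n (right_null P)
           (replicate_mset s (\<alpha> + 1) + replicate_mset (n - r - s) \<alpha>)}
   = {L * R | L R. L \<in> carrier_mat m r \<and> R \<in> carrier_mat r n
      \<and> is_minimal_basis m (cols L) \<and> is_minimal_basis n (rows R)
      \<and> has_minimal_indices m (left_null L)
           (replicate_mset t (\<beta> + 1) + replicate_mset (m - r - t) \<beta>)
      \<and> has_minimal_indices n (right_null R)
           (replicate_mset s (\<alpha> + 1) + replicate_mset (n - r - s) \<alpha>)
      \<and> (\<forall>i<r. vdeg (col L i) + vdeg (row R i) = d)}"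
  (is "?O = ?LR")
proof (intro equalityI subsetI)
  fix P assume "P \<in> ?O"
  then obtain es es' where P: "P \<in> poly_mats m n d" "normal_rank P = r"
    and es: "invariant_polys P es" "\<forall>e\<in>set es. e = 1"
    and es': "invariant_polys (rev_mat d P) es'" "\<forall>e\<in>set es'. order 0 e = 0"
    and ind: "has_minimal_indices m (left_null P)
           (replicate_mset t (\<beta> + 1) + replicate_mset (m - r - t) \<beta>)"
      "has_minimal_indices n (right_null P)
           (replicate_mset s (\<alpha> + 1) + replicate_mset (n - r - s) \<alpha>)"
    unfolding partial_mult_seq_infty_def partial_mult_seq_def by auto
  obtain L Q where L: "L \<in> carrier_mat m r" and Q: "Q \<in> carrier_mat n r" and PLQ: "P = L * Q\<^sup>T"
    and mb: "is_minimal_basis m (cols L)" "is_minimal_basis n (cols Q)"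
    and deg: "\<And>j. j < r \<Longrightarrow> vdeg (col L j) + vdeg (col Q j) = d"
    using minimal_factorization[OF P es es'] by blast
  have R: "Q\<^sup>T \<in> carrier_mat r n" using Q by simp
  have "left_null P = left_null L"
    unfolding PLQ by (rule left_null_mult[OF L R]) (use minimal_basis_inj_fmat[OF Q mb(2)] in simp)
  moreover have "right_null P = right_null (Q\<^sup>T)"
    unfolding PLQ by (rule right_null_mult[OF L R minimal_basis_inj_fmat[OF L mb(1)]])
  ultimately show "P \<in> ?LR"
    using PLQ L R mb ind deg Q by (intro CollectI exI[of _ L] exI[of _ "Q\<^sup>T"]) simp
next
  fix P assume "P \<in> ?LR"
  \<comment> \<open>The rows of \<open>R\<close> are read as the columns of
    \<open>R\<^sup>T\<close>, the form in which the lemmas on minimal bases apply.\<close>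
  then obtain L R where PLR: "P = L * R" and L: "L \<in> carrier_mat m r" and R: "R \<in> carrier_mat r n"
    and mb: "is_minimal_basis m (cols L)" "is_minimal_basis n (cols (R\<^sup>T))"
    and ind: "has_minimal_indices m (left_null L)
           (replicate_mset t (\<beta> + 1) + replicate_mset (m - r - t) \<beta>)"
      "has_minimal_indices n (right_null R)
           (replicate_mset s (\<alpha> + 1) + replicate_mset (n - r - s) \<alpha>)"
    and deg: "\<forall>i<r. vdeg (col L i) + vdeg (row R i) = d"
    by auto
  have Q: "R\<^sup>T \<in> carrier_mat n r" using R by simp
  have "r \<le> m" "r \<le> n" using assms(5) by auto
  moreover have "vdeg (col L j) + vdeg (col (R\<^sup>T) j) = d" if "j < r" for j using deg that R by simp
  ultimately have prod: "P \<in> poly_mats m n d" "normal_rank P = r"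
    "invariant_polys P (replicate r 1)" "invariant_polys (rev_mat d P) (replicate r 1)"
    using minimal_product[OF L Q _ _ mb] PLR by auto
  have "left_null P = left_null L"
    unfolding PLR by (rule left_null_mult[OF L R minimal_basis_inj_fmat[OF Q mb(2)]])
  moreover have "right_null P = right_null R"
    unfolding PLR by (rule right_null_mult[OF L R minimal_basis_inj_fmat[OF L mb(1)]])
  moreover have "partial_mult_seq_infty d P (replicate r 0)"
    unfolding partial_mult_seq_infty_def partial_mult_seq_def
    using prod(4) by (intro exI[of _ "replicate r 1"]) simp
  moreover have "\<exists>es. invariant_polys P es \<and> (\<forall>e\<in>set es. e = 1)"
    using prod(3) by (intro exI[of _ "replicate r 1"]) simp
  moreover have "\<forall>x\<in>set (replicate r (0::nat)). x = 0" by simp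
  ultimately show "P \<in> ?O" using prod(1,2) ind by auto
qed

end
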